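(* Let $n\ge 2$ and $e>0$ be integers, let $S=\mathbb{C}[x_0,\dots,x_n]$, let $W:g=0$ be a smooth projective hypersurface of degree $e$ in $\mathbb{P}^n=\mathbb{P}^n(\mathbb{C})$, with $g\in S_e$, and set $H_i:x_i=0$ for $i=0,\dots,n$. Assume that $V:f=x_0x_1\cdots x_n\,g=0$ is a normal crossing divisor in $\mathbb{P}^n$. For $i=0,\dots,n$ set $g_i'=x_ig_i+g$, where $g_i=\partial g/\partial x_i$. Then a minimal set of generators of the graded $S$-module $D_0(f)$ is given by the syzygies $\rho_{ij}'\in S_{e+1}^{n+1}$, for $0\le i<j\le n$, where $\rho_{ij}'$ has only two non-zero components, namely the $i$-th component equal to $x_ig_j'$ and the $j$-th component equal to $-x_jg_i'$ (components being indexed by $0,\dots,n$).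
   Context: $S=\mathbb{C}[x_0,\dots,x_n]$ has its standard grading and $S_m$ is the space of homogeneous polynomials of degree $m$. For a homogeneous $f\in S$ with partial derivatives $f_j=\partial f/\partial x_j$, the graded $S$-module of Jacobian syzygies is $$D_0(f)=\Big\{(a_0,\dots,a_n)\in S^{n+1} : \sum_{j=0}^n a_jf_j=0\Big\}.$$ The divisor $V$ is a normal crossing divisor if at each point $p\in V$ there are local analytic coordinates $y_1,\dots,y_n$ of $\mathbb{P}^n$ centered at $p$ in which $V$ is defined by $y_1\cdots y_r=0$ for some $1\le r\le n$. *)

theory Defs
  imports
    "HOL-Analysis.Analysis"
    "HOL-Library.Poly_Mapping"
    "HOL-Library.Option_ord"
begin

section \<open>Polynomials with complex coefficients\<close>

text \<open>
  The type \<open>'v mpoly\<close> is the polynomial ring over the complex numbers with one variable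
  for each element of \<open>'v\<close>; a monomial is its exponent vector. Below, the homogeneous
  coordinates \<open>x_0, ..., x_n\<close> of projective \<open>n\<close>-space are indexed by \<open>'n option\<close> with
  \<open>n = CARD('n)\<close>: the index 0 is \<open>None\<close>, and for a finite linearly ordered \<open>'n\<close> the
  indices 1, ..., n are the \<open>Some i\<close> in increasing order, with \<open>None\<close> below all of them.
\<close>

type_synonym 'v mpoly = "('v \<Rightarrow>\<^sub>0 nat) \<Rightarrow>\<^sub>0 complex"

definition Var :: "'v \<Rightarrow> 'v mpoly" where
  "Var i = Poly_Mapping.single (Poly_Mapping.single i 1) 1"

definition eval_mpoly :: "('v::finite) mpoly \<Rightarrow> complex ^ 'v \<Rightarrow> complex" where
  "eval_mpoly p x = (\<Sum>m\<in>Poly_Mapping.keys p.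
     Poly_Mapping.lookup p m * (\<Prod>i\<in>UNIV. (x $ i) ^ Poly_Mapping.lookup m i))"

text \<open>For an exponent vector \<open>m\<close> with \<open>m i = 0\<close> the truncated difference is harmless,
  because the coefficient vanishes.\<close>

definition partial_deriv :: "'v \<Rightarrow> 'v mpoly \<Rightarrow> 'v mpoly" where
  "partial_deriv i p = (\<Sum>m\<in>Poly_Mapping.keys p.
     Poly_Mapping.single (m - Poly_Mapping.single i 1)
       (of_nat (Poly_Mapping.lookup m i) * Poly_Mapping.lookup p m))"

text \<open>Membership in the graded piece of degree \<open>d\<close>; in particular 0 belongs to each piece.\<close>

definition homogeneous :: "nat \<Rightarrow> ('v::finite) mpoly \<Rightarrow> bool" where
  "homogeneous d p \<longleftrightarrow>
     (\<forall>m\<in>Poly_Mapping.keys p. (\<Sum>i\<in>UNIV. Poly_Mapping.lookup m i) = d)"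


section \<open>Jacobian syzygies and minimal generators\<close>

definition D0 :: "('v::finite) mpoly \<Rightarrow> ('v mpoly ^ 'v) set" where
  "D0 f = {a. (\<Sum>j\<in>UNIV. a $ j * partial_deriv j f) = 0}"

lemma module_vec: "module ((*s) :: 'a::comm_ring_1 \<Rightarrow> 'a ^ 'v \<Rightarrow> 'a ^ 'v)"
  by standard (vector algebra_simps)+

text \<open>
  The family \<open>(\<rho> i)\<close>, \<open>i \<in> I\<close>, generates \<open>M\<close> and no proper subfamily does. Since this is
  stated for subfamilies, it also says that the members of the family are pairwise distinct.
\<close>

definition minimal_generators ::
  "'i set \<Rightarrow> ('i \<Rightarrow> ('a::comm_ring_1) ^ 'v) \<Rightarrow> ('a ^ 'v) set \<Rightarrow> bool" where
  "minimal_generators I \<rho> M \<longleftrightarrow>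
     module.span (*s) (\<rho> ` I) = M \<and> (\<forall>J. J \<subset> I \<longrightarrow> module.span (*s) (\<rho> ` J) \<noteq> M)"

definition g' :: "('v::finite) mpoly \<Rightarrow> 'v \<Rightarrow> 'v mpoly" where
  "g' g i = Var i * partial_deriv i g + g"

definition \<rho>' :: "('v::finite) mpoly \<Rightarrow> 'v \<Rightarrow> 'v \<Rightarrow> 'v mpoly ^ 'v" where
  "\<rho>' g i j = (\<chi> k. if k = i then Var i * g' g j
                    else if k = j then - (Var j * g' g i) else 0)"


section \<open>Smooth hypersurfaces and normal crossing divisors in projective space\<close>

text \<open>
  Points of projective space are represented by their nonzero vectors of homogeneous
  coordinates. Smoothness of the hypersurface \<open>g = 0\<close>, as a scheme, is the Jacobian criterion.
\<close>

definition smooth_hypersurface :: "('v::finite) mpoly \<Rightarrow> bool" where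
  "smooth_hypersurface g \<longleftrightarrow>
     (\<forall>p. p \<noteq> 0 \<and> eval_mpoly g p = 0 \<longrightarrow> (\<exists>i. eval_mpoly (partial_deriv i g) p \<noteq> 0))"

text \<open>Holomorphic functions of several variables: the real Frechet derivative exists and is
  complex linear at each point of the open set \<open>U\<close>.\<close>

definition holomorphic_fun :: "(complex ^ 'n \<Rightarrow> complex) \<Rightarrow> (complex ^ 'n) set \<Rightarrow> bool" where
  "holomorphic_fun h U \<longleftrightarrow> open U \<and>
     (\<forall>z\<in>U. \<exists>L. (h has_derivative L) (at z) \<and> (\<forall>c v. L (c *s v) = c * L v))"

definition holomorphic_map ::
  "(complex ^ 'n \<Rightarrow> complex ^ 'm) \<Rightarrow> (complex ^ 'n) set \<Rightarrow> bool" where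
  "holomorphic_map h U \<longleftrightarrow> (\<forall>i. holomorphic_fun (\<lambda>z. h z $ i) U)"

text \<open>\<open>y\<close> maps the open neighbourhood \<open>U\<close> of \<open>a\<close> biholomorphically onto an open set,
  sending \<open>a\<close> to 0.\<close>

definition local_coordinates ::
  "complex ^ 'n \<Rightarrow> (complex ^ 'n) set \<Rightarrow> (complex ^ 'n \<Rightarrow> complex ^ 'n) \<Rightarrow> bool" where
  "local_coordinates a U y \<longleftrightarrow>
     a \<in> U \<and> y a = 0 \<and> holomorphic_map y U \<and> inj_on y U \<and>
     open (y ` U) \<and> holomorphic_map (inv_into U y) (y ` U)"

text \<open>
  The standard affine chart on \<open>x_k \<noteq> 0\<close>. It is indexed by \<open>'n\<close> as follows: position \<open>i\<close>
  holds \<open>x_i / x_k\<close>, except that for \<open>k = Some l\<close> the position \<open>l\<close>, which would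
  hold \<open>x_k / x_k\<close>, holds \<open>x_0 / x_k\<close> instead.
\<close>

definition affine_coords :: "'n option \<Rightarrow> complex ^ ('n option) \<Rightarrow> complex ^ 'n" where
  "affine_coords k x = (\<chi> i. (if k = Some i then x $ None else x $ Some i) / x $ k)"

text \<open>The inverse of the chart: the representative of the point whose coordinate
  \<open>x_k\<close> is 1.\<close>

definition homogeneous_coords :: "'n option \<Rightarrow> complex ^ 'n \<Rightarrow> complex ^ ('n option)" where
  "homogeneous_coords k z =
     (\<chi> j. if j = k then 1 else case j of None \<Rightarrow> z $ the k | Some i \<Rightarrow> z $ i)"

lemma homogeneous_affine_coords:
  fixes x :: "complex ^ (('n::finite) option)"
  assumes "x $ k \<noteq> 0"
  shows "homogeneous_coords k (affine_coords k x) = (1 / x $ k) *s x"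
  using assms
  by (auto simp: homogeneous_coords_def affine_coords_def vec_eq_iff split: option.split)

lemma affine_homogeneous_coords:
  fixes z :: "complex ^ ('n::finite)"
  shows "affine_coords k (homogeneous_coords k z) = z"
  by (auto simp: homogeneous_coords_def affine_coords_def vec_eq_iff)

text \<open>
  The divisor \<open>f = 0\<close> is defined by \<open>y_1 ... y_r = 0\<close> as a divisor, that is with
  multiplicities: the dehomogenization of \<open>f\<close>, which is its local equation, is a nowhere
  vanishing holomorphic function times \<open>y_1 ... y_r\<close>. Coordinates may be renumbered, so
  the initial segment 1, ..., r is replaced by a nonempty set \<open>R\<close> of positions; \<open>r = card R\<close>
  then satisfies \<open>1 \<le> r \<le> n\<close>.
\<close>

definition normal_crossing_at ::
  "(('n::finite) option) mpoly \<Rightarrow> complex ^ ('n option) \<Rightarrow> bool" where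
  "normal_crossing_at f p \<longleftrightarrow>
     (\<exists>k U y R u. p $ k \<noteq> 0 \<and> local_coordinates (affine_coords k p) U y \<and>
        R \<noteq> {} \<and> holomorphic_fun u U \<and>
        (\<forall>z\<in>U. u z \<noteq> 0 \<and>
           eval_mpoly f (homogeneous_coords k z) = u z * (\<Prod>i\<in>R. y z $ i)))"

definition normal_crossing_divisor :: "(('n::finite) option) mpoly \<Rightarrow> bool" where
  "normal_crossing_divisor f \<longleftrightarrow>
     (\<forall>p. p \<noteq> 0 \<and> eval_mpoly f p = 0 \<longrightarrow> normal_crossing_at f p)"

end

theory Submission
  imports Defs "HOL-Computational_Algebra.Fundamental_Theorem_Algebra"
begin

text \<open>
  Since \<open>f_j = (\<Prod>i\<noteq>j. x_i) g'_j\<close> and \<open>x_j\<close> does not divide \<open>g\<close>, a syzygy of the partial derivatives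
  of \<open>f\<close> has the form \<open>(x_j b_j)\<close> with \<open>\<Sum>j. b_j g'_j = 0\<close>. The normal crossing condition forces
  the \<open>n + 1\<close> forms \<open>g'_j\<close> to have no common zero in projective space, so by the Nullstellensatz
  each variable has a power in the ideal \<open>(g'_0, ..., g'_n)\<close>. These powers form a regular sequence
  of length \<open>n + 1\<close>, which makes the Koszul complex of the \<open>g'_j\<close> exact; hence \<open>b\<close> is a
  combination of the Koszul syzygies. A redundant \<open>\<rho>'_ij\<close> would give a syzygy of the \<open>g'_j\<close> with a
  coefficient 1, contradicting that syzygies have coefficients in the ideal of the \<open>g'_j\<close>.
\<close>

text \<open>That the \<open>g'_j\<close> are themselves a regular sequence is a fact of dimension
  theory. Powers of the variables avoid it: being a nonzerodivisor modulo a monomial ideal is a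
  condition on exponents, and every element of the ideal of the \<open>g'_j\<close> annihilates
  their Koszul homology. The number \<open>n + 1\<close> of powers matters because each of them
  lowers the degree in which homology is known to vanish by one, from \<open>n + 2\<close>, where
  alternating forms are 0, to 1, where the syzygies live.

  Common zeros are located by Euler's formula: the sum of the \<open>g'_j\<close> is
  \<open>(n + 1 + e) g\<close>, so a common zero lies on \<open>g = 0\<close> and all
  \<open>x_j g_j\<close> vanish there. The normal crossing condition is exploited only through
  limits along complex lines through that point, which give the order of vanishing and the leading
  form of \<open>f\<close>. The absence of common zeros also shows that \<open>x_j\<close> does not
  divide \<open>g\<close>, since otherwise it would divide every \<open>g'_i\<close>.\<close>

abbreviation lookup :: "('a \<Rightarrow>\<^sub>0 'b::zero) \<Rightarrow> 'a \<Rightarrow> 'b" where "lookup \<equiv> Poly_Mapping.lookup"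
abbreviation keys :: "('a \<Rightarrow>\<^sub>0 'b::zero) \<Rightarrow> 'a set" where "keys \<equiv> Poly_Mapping.keys"
abbreviation single :: "'a \<Rightarrow> 'b \<Rightarrow> 'a \<Rightarrow>\<^sub>0 'b::zero" where "single \<equiv> Poly_Mapping.single"

abbreviation Const :: "complex \<Rightarrow> 'v mpoly" where "Const c \<equiv> single 0 c"

section \<open>Polynomial arithmetic\<close>

lemma update_eq_single_add:
  fixes p :: "'a \<Rightarrow>\<^sub>0 'b::comm_monoid_add"
  assumes "m \<notin> keys p"
  shows "Poly_Mapping.update m c p = single m c + p"
  using assms
  by (intro poly_mapping_eqI) (auto simp: lookup_update lookup_add lookup_single in_keys_iff)

lemma mpoly_induct [case_names zero add]:
  fixes p :: "'a \<Rightarrow>\<^sub>0 'b::comm_monoid_add"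
  assumes "P 0" and "\<And>p m c. P p \<Longrightarrow> P (single m c + p)"
  shows "P p"
proof (induction p rule: update_induct)
  case (update f a b)
  then show ?case using assms(2)[of f a b] by (simp add: update_eq_single_add)
qed (fact assms(1))

text \<open>Both sides are biadditive in \<open>p\<close> and \<open>q\<close>, so pairs of
  monomials decide.\<close>

lemma additive_multI:
  fixes T :: "'v mpoly \<Rightarrow> 'b::comm_ring_1"
  assumes zero: "T 0 = 0" and add: "\<And>p q. T (p + q) = T p + T q"
    and single: "\<And>m a m' b. T (single (m + m') (a * b)) = T (single m a) * T (single m' b)"
  shows "T (p * q) = T p * T q"
proof (induction p rule: mpoly_induct)
  case (add p m c)
  have "T (single m c * q) = T (single m c) * T q"
    by (induction q rule: mpoly_induct) (simp_all add: zero assms(2) single mult_single algebra_simps)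
  then show ?case using add by (simp add: assms(2) algebra_simps)
qed (simp add: zero)

text \<open>Multiplication by a monomial translates coefficients. Cancelling monomials is thus a
  comparison of coefficients and needs no order on the variables.\<close>

lemma lookup_single_mult:
  fixes p :: "'v mpoly"
  shows "lookup (single t c * p) (t + m) = c * lookup p m"
  by (induction p rule: mpoly_induct) (auto simp: mult_single lookup_add lookup_single when_def algebra_simps)

lemma lookup_Const_mult: "lookup (Const c * p) m = c * lookup p m"
  using lookup_single_mult[of 0 c p m] by simp

lemma Var_power: "Var i ^ N = single (single i N) 1"
  by (induction N) (simp_all add: Var_def mult_single single_one flip: single_add)

lemma Var_power_cancel:
  assumes "Var i ^ N * p = Var i ^ N * q"
  shows "p = q"
proof (rule poly_mapping_eqI)
  fix m
  show "lookup p m = lookup q m"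
    using lookup_single_mult[of "single i N" 1 p m] lookup_single_mult[of "single i N" 1 q m] assms
    by (simp add: Var_power)
qed

lemma Var_cancel: "Var i * p = Var i * q \<longleftrightarrow> p = q"
  using Var_power_cancel[of i 1 p q] by auto

lemma prod_Var_cancel: "finite A \<Longrightarrow> (\<Prod>i\<in>A. Var i) * p = (\<Prod>i\<in>A. Var i) * q \<Longrightarrow> p = q"
  by (induction A arbitrary: p q rule: finite_induct) (auto simp: mult.assoc Var_cancel)

lemma add_single_diff:
  fixes m :: "'v \<Rightarrow>\<^sub>0 nat"
  assumes "k \<le> lookup m i"
  shows "single i k + (m - single i k) = m" "(m - single i k) + single i k = m"
  using assms by (auto intro!: poly_mapping_eqI simp: lookup_add lookup_minus lookup_single when_def)

lemma single_eq_prod_Var: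
  fixes m :: "('v::finite) \<Rightarrow>\<^sub>0 nat"
  shows "single m c = Const c * (\<Prod>v\<in>UNIV. Var v ^ lookup m v)"
proof -
  have "(\<Prod>v\<in>A. single (single v (lookup m v)) (1::complex)) = single (\<Sum>v\<in>A. single v (lookup m v)) 1" for A
    by (induction A rule: infinite_finite_induct) (simp_all add: mult_single)
  moreover have "(\<Sum>v\<in>UNIV. single v (lookup m v)) = m"
    by (intro poly_mapping_eqI) (simp add: lookup_sum lookup_single when_def)
  ultimately show ?thesis by (simp add: Var_power mult_single)
qed

lemma mpoly_ring_induct [case_names Const Var add mult]:
  fixes p :: "('v::finite) mpoly"
  assumes Const: "\<And>c. P (Const c)" and Var: "\<And>v. P (Var v)"
    and add: "\<And>p q. P p \<Longrightarrow> P q \<Longrightarrow> P (p + q)" and mult: "\<And>p q. P p \<Longrightarrow> P q \<Longrightarrow> P (p * q)"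
  shows "P p"
proof (induction p rule: mpoly_induct)
  case zero
  show ?case using Const[of 0] by simp
next
  case (add p m c)
  have one: "P 1" using Const[of 1] by simp
  have "P (Var v ^ k)" for v k
    by (induction k) (simp_all add: one Var mult)
  then have "P (\<Prod>v\<in>A. Var v ^ lookup m v)" for A
    by (induction A rule: infinite_finite_induct) (simp_all add: one mult)
  then have "P (single m c)" by (subst single_eq_prod_Var) (intro mult Const)
  then show ?case using assms(3) add by blast
qed


subsection \<open>Evaluation\<close>

lemma eval_zero [simp]: "eval_mpoly 0 x = 0"
  by (simp add: eval_mpoly_def)

lemma eval_single [simp]: "eval_mpoly (single m c) x = c * (\<Prod>i\<in>UNIV. (x $ i) ^ lookup m i)"
  by (simp add: eval_mpoly_def)

lemma eval_add [simp]: "eval_mpoly (p + q) x = eval_mpoly p x + eval_mpoly q x"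
  unfolding eval_mpoly_def by (rule setsum_keys_plus_distrib) (simp_all add: algebra_simps)

lemma eval_mult [simp]: "eval_mpoly (p * q) x = eval_mpoly p x * eval_mpoly q x"
  by (rule additive_multI[of "\<lambda>p. eval_mpoly p x"])
     (simp_all add: lookup_add power_add prod.distrib)

lemma eval_one [simp]: "eval_mpoly 1 x = 1"
  using eval_single[of 0 1 x] by (simp add: single_one)

lemma eval_uminus [simp]: "eval_mpoly (- p) x = - eval_mpoly p x"
  using eval_add[of p "- p" x] by (simp add: add_eq_0_iff)

lemma eval_diff [simp]: "eval_mpoly (p - q) x = eval_mpoly p x - eval_mpoly q x"
  using eval_add[of p "- q" x] by simp

lemma eval_Var [simp]: "eval_mpoly (Var i) x = x $ i"
proof -
  have "(\<Prod>j\<in>UNIV. (x $ j) ^ lookup (single i 1) j) = (\<Prod>j\<in>UNIV. if j = i then x $ i else 1)"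
    by (intro prod.cong) (auto simp: lookup_single when_def)
  then show ?thesis by (simp add: Var_def)
qed

lemma eval_Const: "eval_mpoly (Const c) x = c"
  by simp

lemma eval_sum [simp]: "eval_mpoly (\<Sum>i\<in>A. p i) x = (\<Sum>i\<in>A. eval_mpoly (p i) x)"
  by (induction A rule: infinite_finite_induct) auto

lemma eval_prod [simp]: "eval_mpoly (\<Prod>i\<in>A. p i) x = (\<Prod>i\<in>A. eval_mpoly (p i) x)"
  by (induction A rule: infinite_finite_induct) auto


subsection \<open>Partial derivatives\<close>

lemma partial_deriv_zero [simp]: "partial_deriv i 0 = 0"
  by (simp add: partial_deriv_def)

lemma partial_deriv_single:
  "partial_deriv i (single m c) = single (m - single i 1) (of_nat (lookup m i) * c)"
  by (simp add: partial_deriv_def)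

lemma partial_deriv_add [simp]: "partial_deriv i (p + q) = partial_deriv i p + partial_deriv i q"
  unfolding partial_deriv_def
  by (rule setsum_keys_plus_distrib) (simp_all add: algebra_simps single_add)

text \<open>The operator \<open>x_i d/dx_i\<close> is diagonal on monomials, so truncated exponents
  disappear. Degree preservation and Euler's formula follow directly, the Leibniz rule after
  cancelling \<open>x_i\<close>.\<close>

lemma lookup_Var_partial_deriv:
  "lookup (Var i * partial_deriv i p) m = of_nat (lookup m i) * lookup p m"
proof (induction p rule: mpoly_induct)
  case (add p m' c)
  have "Var i * partial_deriv i (single m' c) = single m' (of_nat (lookup m' i) * c)"
  proof (cases "lookup m' i = 0")
    case False
    then show ?thesis
      using add_single_diff[of 1 m' i] by (simp add: Var_def partial_deriv_single mult_single)
  qed (simp add: partial_deriv_single)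
  then show ?case using add by (auto simp: algebra_simps lookup_add lookup_single when_def)
qed simp

lemma Var_partial_deriv_mult:
  "Var i * partial_deriv i (p * q) =
     Var i * partial_deriv i p * q + p * (Var i * partial_deriv i q)"
proof -
  define D where "D p = Var i * partial_deriv i p" for p :: "'a mpoly"
  have add: "D (p + q) = D p + D q" and zero: "D 0 = 0" for p q
    by (simp_all add: D_def algebra_simps)
  have single: "D (single m c) = single m (of_nat (lookup m i) * c)" for m c
    by (intro poly_mapping_eqI) (simp add: D_def lookup_Var_partial_deriv lookup_single when_def)
  have "D (p * q) = D p * q + p * D q"
  proof (induction p rule: mpoly_induct)
    case (add p m c)
    have "D (single m c * q) = D (single m c) * q + single m c * D q"
      by (induction q rule: mpoly_induct)
         (simp_all add: zero \<open>\<And>p q. D (p + q) = D p + D q\<close> single mult_single lookup_add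
           algebra_simps flip: single_add)
    then show ?case using add by (simp add: \<open>\<And>p q. D (p + q) = D p + D q\<close> algebra_simps)
  qed (simp add: zero)
  then show ?thesis by (simp add: D_def)
qed

lemma partial_deriv_mult:
  "partial_deriv i (p * q) = partial_deriv i p * q + p * partial_deriv i q"
  using Var_partial_deriv_mult[of i p q] Var_cancel[of i "partial_deriv i (p * q)"
      "partial_deriv i p * q + p * partial_deriv i q"]
  by (simp add: algebra_simps)

lemma partial_deriv_Var: "partial_deriv i (Var j) = (if i = j then 1 else 0)"
proof -
  have "single j (Suc 0) - single j 1 = 0"
    by (intro poly_mapping_eqI) (simp add: lookup_minus)
  then show ?thesis
    by (auto simp: Var_def partial_deriv_single lookup_single single_one when_def)
qed

lemma partial_deriv_prod_Var:
  "finite A \<Longrightarrow> partial_deriv i (\<Prod>j\<in>A. Var j) = (if i \<in> A then \<Prod>j\<in>A - {i}. Var j else 0)"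
proof (induction A rule: finite_induct)
  case empty
  have "partial_deriv i (single 0 1) = 0" by (simp only: partial_deriv_single) simp
  then show ?case by (simp add: single_one)
next
  case (insert x A)
  then show ?case
    by (cases "i = x") (auto simp: partial_deriv_mult partial_deriv_Var insert_Diff_if)
qed


subsection \<open>Homogeneous polynomials\<close>

lemma homogeneous_add: "homogeneous d p \<Longrightarrow> homogeneous d q \<Longrightarrow> homogeneous d (p + q)"
  using keys_add[of p q] by (auto simp: homogeneous_def)

lemma homogeneous_uminus: "homogeneous d p \<Longrightarrow> homogeneous d (- p)"
  by (simp add: homogeneous_def in_keys_iff)

lemma homogeneous_mult:
  assumes "homogeneous d p" "homogeneous d' q"
  shows "homogeneous (d + d') (p * q)"
  unfolding homogeneous_def
proof
  fix m assume "m \<in> keys (p * q)"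
  then obtain a b where "m = a + b" "a \<in> keys p" "b \<in> keys q" using keys_mult[of p q] by auto
  then show "(\<Sum>i\<in>UNIV. lookup m i) = d + d'"
    using assms by (simp add: homogeneous_def lookup_add sum.distrib)
qed

lemma homogeneous_Var: "homogeneous 1 (Var i)"
proof -
  have "(\<Sum>j\<in>UNIV. lookup (single i (1::nat)) j) = (\<Sum>j\<in>UNIV. if j = i then 1 else 0)"
    by (intro sum.cong) (auto simp: lookup_single when_def)
  then show ?thesis by (simp add: homogeneous_def Var_def)
qed

lemma homogeneous_zero: "homogeneous d 0"
  by (simp add: homogeneous_def)

lemma homogeneous_Var_partial_deriv:
  "homogeneous d p \<Longrightarrow> homogeneous d (Var i * partial_deriv i p)"
  by (auto simp: homogeneous_def in_keys_iff lookup_Var_partial_deriv)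

lemma homogeneous_g': "homogeneous d g \<Longrightarrow> homogeneous d (g' g i)"
  by (simp add: g'_def homogeneous_add homogeneous_Var_partial_deriv)

lemma homogeneous_eval_scale:
  assumes "homogeneous d p"
  shows "eval_mpoly p (c *s x) = c ^ d * eval_mpoly p x"
  unfolding eval_mpoly_def sum_distrib_left
proof (rule sum.cong)
  fix m assume "m \<in> keys p"
  then have "(\<Prod>i\<in>UNIV. c ^ lookup m i) = c ^ d"
    using assms by (simp add: homogeneous_def flip: power_sum)
  then show "lookup p m * (\<Prod>i\<in>UNIV. ((c *s x) $ i) ^ lookup m i) =
      c ^ d * (lookup p m * (\<Prod>i\<in>UNIV. (x $ i) ^ lookup m i))"
    by (simp add: power_mult_distrib prod.distrib)
qed simp

lemma euler_homogeneous:
  assumes "homogeneous d p"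
  shows "(\<Sum>i\<in>UNIV. Var i * partial_deriv i p) = of_nat d * p"
proof (rule poly_mapping_eqI)
  fix m
  have "lookup (of_nat d * p) m = of_nat d * lookup p m"
    using lookup_Const_mult[of "of_nat d" p m] by simp
  moreover have "(\<Sum>i\<in>UNIV. of_nat (lookup m i) * lookup p m) = of_nat d * lookup p m"
    using assms
    by (cases "m \<in> keys p") (auto simp: homogeneous_def in_keys_iff simp flip: sum_distrib_right of_nat_sum)
  ultimately show "lookup (\<Sum>i\<in>UNIV. Var i * partial_deriv i p) m = lookup (of_nat d * p) m"
    by (simp add: lookup_sum lookup_Var_partial_deriv)
qed

section \<open>Nullstellensatz\<close>

text \<open>Gaussian elimination on more vectors than coordinates. It serves both the inverses in
  the Nullstellensatz and the linear forms at a normal crossing.\<close>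

lemma nontrivial_relation:
  fixes v :: "'c \<Rightarrow> 'm \<Rightarrow> 'k::field"
  assumes "finite F" "finite C" "card F < card C"
  shows "\<exists>\<alpha>. (\<exists>c\<in>C. \<alpha> c \<noteq> 0) \<and> (\<forall>m\<in>F. (\<Sum>c\<in>C. \<alpha> c * v c m) = 0)"
  using assms
proof (induction F arbitrary: C v rule: finite_induct)
  case empty
  then obtain c where "c \<in> C" by fastforce
  then show ?case by (intro exI[of _ "\<lambda>_. 1"]) auto
next
  case (insert m F)
  show ?case
  proof (cases "\<forall>c\<in>C. v c m = 0")
    case True
    moreover have "card F < card C" using insert by simp
    ultimately show ?thesis using insert.IH[OF insert.prems(1), of v] by auto
  next
    case False
    then obtain c0 where c0: "c0 \<in> C" "v c0 m \<noteq> 0" by auto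
    \<comment> \<open>The pivot \<open>c0\<close> clears coordinate \<open>m\<close> from the other
      vectors; the coefficient \<open>- s\<close> of the pivot later undoes this change.\<close>
    define v' where "v' c i = v c i - v c m / v c0 m * v c0 i" for c i
    have "card F < card (C - {c0})" using insert c0 by simp
    then obtain \<alpha> where \<alpha>: "\<exists>c\<in>C - {c0}. \<alpha> c \<noteq> 0"
      "\<forall>i\<in>F. (\<Sum>c\<in>C - {c0}. \<alpha> c * v' c i) = 0"
      using insert.IH[of "C - {c0}" v'] insert.prems by auto
    define s where "s = (\<Sum>c\<in>C - {c0}. \<alpha> c * v c m) / v c0 m"
    define \<beta> where "\<beta> = \<alpha>(c0 := - s)"
    have \<beta>: "(\<Sum>c\<in>C. \<beta> c * v c i) = (\<Sum>c\<in>C - {c0}. \<alpha> c * v c i) - s * v c0 i" for i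
    proof -
      have "(\<Sum>c\<in>C. \<beta> c * v c i) = \<beta> c0 * v c0 i + (\<Sum>c\<in>C - {c0}. \<beta> c * v c i)"
        using c0 insert.prems by (intro sum.remove) auto
      also have "(\<Sum>c\<in>C - {c0}. \<beta> c * v c i) = (\<Sum>c\<in>C - {c0}. \<alpha> c * v c i)"
        by (intro sum.cong) (auto simp: \<beta>_def)
      finally show ?thesis by (simp add: \<beta>_def)
    qed
    have "(\<Sum>c\<in>C - {c0}. \<alpha> c * v' c i) = (\<Sum>c\<in>C - {c0}. \<alpha> c * v c i) - s * v c0 i" for i
      by (simp add: v'_def s_def right_diff_distrib sum_subtractf sum_distrib_right
          sum_divide_distrib mult.assoc)
    then have "\<forall>i\<in>F. (\<Sum>c\<in>C. \<beta> c * v c i) = 0" using \<alpha>(2) \<beta> by simp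
    moreover have "(\<Sum>c\<in>C. \<beta> c * v c m) = 0" using c0 by (simp add: \<beta> s_def)
    moreover have "\<exists>c\<in>C. \<beta> c \<noteq> 0" using \<alpha>(1) by (auto simp: \<beta>_def)
    ultimately show ?thesis by blast
  qed
qed

section \<open>Ideals of a commutative ring and adjunction of an element\<close>

definition is_ideal :: "'a::comm_ring_1 set \<Rightarrow> bool" where
  "is_ideal I \<longleftrightarrow> 0 \<in> I \<and> (\<forall>a\<in>I. \<forall>b\<in>I. a + b \<in> I) \<and> (\<forall>a\<in>I. \<forall>r. r * a \<in> I)"

lemma is_idealD:
  assumes "is_ideal I"
  shows "0 \<in> I" "a \<in> I \<Longrightarrow> b \<in> I \<Longrightarrow> a + b \<in> I" "a \<in> I \<Longrightarrow> r * a \<in> I" "a \<in> I \<Longrightarrow> a * r \<in> I"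
    "a \<in> I \<Longrightarrow> - a \<in> I" "a \<in> I \<Longrightarrow> b \<in> I \<Longrightarrow> a - b \<in> I"
proof -
  show 1: "0 \<in> I" "a \<in> I \<Longrightarrow> b \<in> I \<Longrightarrow> a + b \<in> I" "a \<in> I \<Longrightarrow> r * a \<in> I" for a b r
    using assms by (auto simp: is_ideal_def)
  show "a \<in> I \<Longrightarrow> a * r \<in> I" using 1(3)[of a r] by (simp add: mult.commute)
  show 2: "a \<in> I \<Longrightarrow> - a \<in> I" for a using 1(3)[of a "-1"] by simp
  show "a \<in> I \<Longrightarrow> b \<in> I \<Longrightarrow> a - b \<in> I" using 1(2)[of a "- b"] 2[of b] by simp
qed

lemma is_ideal_sum: "is_ideal I \<Longrightarrow> (\<And>i. i \<in> A \<Longrightarrow> f i \<in> I) \<Longrightarrow> (\<Sum>i\<in>A. f i) \<in> I"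
  by (induction A rule: infinite_finite_induct) (auto intro: is_idealD)

definition combos :: "('i::finite \<Rightarrow> 'a::comm_ring_1) \<Rightarrow> 'a set" where
  "combos h = {\<Sum>i\<in>UNIV. c i * h i | c. True}"

lemma is_ideal_combos: "is_ideal (combos h)"
  unfolding is_ideal_def combos_def
proof (safe, goal_cases)
  case 1 show ?case by (rule exI[of _ "\<lambda>_. 0"]) simp
next
  case (2 _ _ c c') show ?case
    by (rule exI[of _ "\<lambda>i. c i + c' i"]) (simp add: algebra_simps sum.distrib)
next
  case (3 _ c r) show ?case
    by (rule exI[of _ "\<lambda>i. r * c i"]) (simp add: algebra_simps sum_distrib_left)
qed

lemma combos_member: "h i \<in> combos h"
  unfolding combos_def
  by (rule CollectI, rule exI[of _ "\<lambda>j. if j = i then 1 else 0"])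
     (simp add: if_distrib[of "\<lambda>c. c * _"] cong: if_cong)

lemma combos_mult: "c * h i \<in> combos h"
  using is_idealD(3)[OF is_ideal_combos combos_member] .

definition adjoin :: "'a::comm_ring_1 set \<Rightarrow> 'a \<Rightarrow> 'a set" where
  "adjoin I x = {a + x * q | a q. a \<in> I}"

lemma adjoin:
  assumes "is_ideal I"
  shows "is_ideal (adjoin I x)" "I \<subseteq> adjoin I x" "x \<in> adjoin I x"
proof -
  show "is_ideal (adjoin I x)"
    unfolding is_ideal_def adjoin_def
  proof (intro conjI ballI allI)
    show "0 \<in> {a + x * q | a q. a \<in> I}"
      by (intro CollectI exI[of _ 0]) (simp add: is_idealD(1)[OF assms])
  next
    fix s t assume "s \<in> {a + x * q | a q. a \<in> I}" "t \<in> {a + x * q | a q. a \<in> I}"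
    then obtain a q b r where "s = a + x * q" "a \<in> I" "t = b + x * r" "b \<in> I" by blast
    then show "s + t \<in> {a + x * q | a q. a \<in> I}"
      by (intro CollectI exI[of _ "a + b"] exI[of _ "q + r"])
         (simp add: algebra_simps is_idealD(2)[OF assms])
  next
    fix s u assume "s \<in> {a + x * q | a q. a \<in> I}"
    then obtain a q where "s = a + x * q" "a \<in> I" by blast
    then show "u * s \<in> {a + x * q | a q. a \<in> I}"
      by (intro CollectI exI[of _ "u * a"] exI[of _ "u * q"])
         (simp add: algebra_simps is_idealD(4)[OF assms])
  qed
  show "I \<subseteq> adjoin I x"
  proof
    fix a assume "a \<in> I"
    then show "a \<in> adjoin I x" unfolding adjoin_def by (intro CollectI exI[of _ a] exI[of _ 0]) simp
  qed
  show "x \<in> adjoin I x" unfolding adjoin_def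
    by (intro CollectI exI[of _ 0] exI[of _ 1]) (simp add: is_idealD(1)[OF assms])
qed

lemma not_in_adjoin_inverse:
  assumes "1 \<in> adjoin I x" "is_ideal I"
  shows "\<exists>q. x * q - 1 \<in> I"
proof -
  obtain a q where "1 = a + x * q" "a \<in> I" using assms(1) by (auto simp: adjoin_def)
  then have "x * q - 1 = - a" by (simp add: algebra_simps)
  then show ?thesis using \<open>a \<in> I\<close> is_idealD(5)[OF assms(2)] by metis
qed

lemma in_ideal_cancel_invertible:
  assumes "is_ideal I" "x * q - 1 \<in> I" "x * a \<in> I"
  shows "a \<in> I"
proof -
  have "a = q * (x * a) - a * (x * q - 1)" by (simp add: algebra_simps)
  then show ?thesis using is_idealD[OF assms(1)] assms(2,3) by metis
qed

section \<open>Substitution of a ring element into univariate complex polynomials\<close>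

definition eval_poly_at :: "'v mpoly \<Rightarrow> complex poly \<Rightarrow> 'v mpoly" where
  "eval_poly_at x P = poly (map_poly (\<lambda>c. Const c) P) x"

lemma eval_poly_at_0 [simp]: "eval_poly_at x 0 = 0"
  by (simp add: eval_poly_at_def)

lemma eval_poly_at_pCons [simp]: "eval_poly_at x (pCons a P) = Const a + x * eval_poly_at x P"
  by (simp add: eval_poly_at_def map_poly_pCons)

lemma eval_poly_at_1 [simp]: "eval_poly_at x 1 = 1"
  by (simp flip: pCons_one)

lemma eval_poly_at_add: "eval_poly_at x (P + Q) = eval_poly_at x P + eval_poly_at x Q"
  by (induction P Q rule: poly_induct2) (simp_all add: single_add algebra_simps)

lemma eval_poly_at_smult: "eval_poly_at x (smult a P) = Const a * eval_poly_at x P"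
  by (induction P) (simp_all add: mult_single algebra_simps)

lemma eval_poly_at_mult: "eval_poly_at x (P * Q) = eval_poly_at x P * eval_poly_at x Q"
  by (induction P) (simp_all add: eval_poly_at_add eval_poly_at_smult algebra_simps)

lemma eval_poly_at_prod: "eval_poly_at x (\<Prod>i\<in>A. P i) = (\<Prod>i\<in>A. eval_poly_at x (P i))"
  by (induction A rule: infinite_finite_induct) (simp_all add: eval_poly_at_mult)

lemma eval_poly_at_sum: "eval_poly_at x (\<Sum>i\<in>A. P i) = (\<Sum>i\<in>A. eval_poly_at x (P i))"
  by (induction A rule: infinite_finite_induct) (simp_all add: eval_poly_at_add)

lemma Const_minus: "Const (- c) = - Const c"
  by (simp add: single_uminus)

text \<open>Over the complex numbers \<open>P\<close> splits into linear factors. Each becomes some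
  \<open>x - Const r\<close>, invertible modulo \<open>I\<close>, and is cancelled until a nonzero
  constant is left in \<open>I\<close>.\<close>

lemma one_in_ideal_of_eval_poly_at:
  assumes I: "is_ideal I" and inv: "\<And>c. \<exists>q. (x - Const c) * q - 1 \<in> I"
    and "P \<noteq> 0" "eval_poly_at x P \<in> I"
  shows "1 \<in> I"
  using assms(3,4)
proof (induction "degree P" arbitrary: P rule: less_induct)
  case less
  show ?case
  proof (cases "degree P = 0")
    case True
    then obtain a where "P = [:a:]" by (rule degree_eq_zeroE)
    then have "Const a \<in> I" "a \<noteq> 0" using less.prems by auto
    then have "Const (1 / a) * Const a \<in> I" using I by (intro is_idealD)
    then show ?thesis using \<open>a \<noteq> 0\<close> by (simp add: mult_single)
  next
    case False
    then obtain r where "poly P r = 0"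
      using fundamental_theorem_of_algebra[of P] constant_degree[of P] by auto
    then obtain Q where Q: "P = [:- r, 1:] * Q" by (metis poly_eq_0_iff_dvd dvdE)
    have "(x - Const r) * eval_poly_at x Q \<in> I"
      using less.prems unfolding Q eval_poly_at_mult by (simp add: Const_minus)
    then have "eval_poly_at x Q \<in> I"
      using in_ideal_cancel_invertible[OF I] inv by blast
    moreover have "Q \<noteq> 0" "degree Q < degree P"
      using less.prems(1) unfolding Q by (auto simp: degree_mult_eq simp del: mult_pCons_left)
    ultimately show ?thesis using less.hyps by blast
  qed
qed

text \<open>The inverses of the uncountably many \<open>x - c\<close> live in a space of countable dimension.\<close>

lemma ex_proper_adjoin:
  fixes I :: "('v::finite) mpoly set"
  assumes I: "is_ideal I" and "1 \<notin> I"
  shows "\<exists>c. 1 \<notin> adjoin I (x - Const c)"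
proof (rule ccontr)
  assume "\<not> ?thesis"
  then have inv: "\<exists>q. (x - Const c) * q - 1 \<in> I" for c
    using not_in_adjoin_inverse[OF _ I] by blast
  then obtain q where q: "(x - Const c) * q c - 1 \<in> I" for c by metis
  \<comment> \<open>There are countably many finite sets of monomials but uncountably many
    \<open>c\<close>, so one support \<open>F\<close> is shared by infinitely many inverses.\<close>
  have "\<exists>F. infinite ((\<lambda>c. keys (q c)) -` {F})"
  proof (rule ccontr)
    assume "\<not> ?thesis"
    then have fin: "\<And>F. finite ((\<lambda>c. keys (q c)) -` {F})" by blast
    have cnt: "countable (UNIV :: ('v \<Rightarrow>\<^sub>0 nat) set)"
    proof (rule countable_subset)
      show "UNIV \<subseteq> Poly_Mapping.Abs_poly_mapping ` (UNIV :: ('v \<Rightarrow> nat) set)"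
        by (metis lookup_Abs_poly_mapping poly_mapping.lookup_inverse rangeI subsetI)
    qed auto
    have "(UNIV::complex set) = (\<Union>F\<in>{F. finite F}. (\<lambda>c. keys (q c)) -` {F})"
      by auto
    moreover have "countable (\<Union>F\<in>{F. finite F}. (\<lambda>c. keys (q c)) -` {F})"
      using fin cnt countable_Collect_finite_subset[OF cnt]
      by (intro countable_UN) (auto intro: countable_finite)
    ultimately show False using uncountable_UNIV_complex by metis
  qed
  then obtain F where F: "infinite ((\<lambda>c. keys (q c)) -` {F})" by blast
  then have "finite F" by (metis (mono_tags) finite_keys ex_in_conv finite.emptyI vimageE singletonD)
  obtain C where C: "C \<subseteq> (\<lambda>c. keys (q c)) -` {F}" "finite C" "card C = Suc (card F)"
    using infinite_arbitrarily_large[OF F] by blast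
  obtain \<alpha> where \<alpha>: "\<exists>c\<in>C. \<alpha> c \<noteq> 0" "\<forall>m\<in>F. (\<Sum>c\<in>C. \<alpha> c * lookup (q c) m) = 0"
    using nontrivial_relation[OF \<open>finite F\<close> C(2), of "\<lambda>c m. lookup (q c) m"] C(3) by auto
  have rel: "(\<Sum>c\<in>C. Const (\<alpha> c) * q c) = 0"
  proof (rule poly_mapping_eqI)
    fix m
    have "(\<Sum>c\<in>C. \<alpha> c * lookup (q c) m) = 0"
    proof (cases "m \<in> F")
      case False
      then have "lookup (q c) m = 0" if "c \<in> C" for c using C(1) that by (auto simp: in_keys_iff)
      then show ?thesis by simp
    qed (use \<alpha> in auto)
    then show "lookup (\<Sum>c\<in>C. Const (\<alpha> c) * q c) m = lookup 0 m"
      by (simp add: lookup_sum lookup_Const_mult)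
  qed
  \<comment> \<open>Modulo \<open>I\<close> the relation says that the sum of the
    \<open>\<alpha> c / (x - c)\<close> is 0; \<open>P\<close> is its numerator over the common
    denominator. At a root \<open>c0\<close> of that denominator only the term of \<open>c0\<close>
    survives, hence \<open>P \<noteq> 0\<close>.\<close>
  define P where "P = (\<Sum>c\<in>C. smult (\<alpha> c) (\<Prod>d\<in>C - {c}. [:- d, 1:]))"
  have "P \<noteq> 0"
  proof -
    obtain c0 where c0: "c0 \<in> C" "\<alpha> c0 \<noteq> 0" using \<alpha> by auto
    have "poly P c0 = (\<Sum>c\<in>C. \<alpha> c * (\<Prod>d\<in>C - {c}. c0 - d))"
      by (simp add: P_def poly_sum poly_prod)
    also have "\<dots> = (\<Sum>c\<in>C. if c = c0 then \<alpha> c * (\<Prod>d\<in>C - {c}. c0 - d) else 0)"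
      using c0 C(2) by (intro sum.cong) auto
    also have "\<dots> = \<alpha> c0 * (\<Prod>d\<in>C - {c0}. c0 - d)" using c0 C(2) by simp
    also have "\<dots> \<noteq> 0" using c0 C(2) by auto
    finally show ?thesis by auto
  qed
  moreover have "eval_poly_at x P \<in> I"
  proof -
    define X where "X = (\<Prod>d\<in>C. x - Const d)"
    define Y where "Y c = (\<Prod>d\<in>C - {c}. x - Const d)" for c
    have X: "X = (x - Const c) * Y c" if "c \<in> C" for c
      using that C(2) by (simp add: X_def Y_def prod.remove)
    have "eval_poly_at x P = (\<Sum>c\<in>C. Const (\<alpha> c) * Y c)"
      by (simp add: P_def Y_def eval_poly_at_sum eval_poly_at_smult eval_poly_at_prod Const_minus)
    \<comment> \<open>Subtracting a multiple of the relation, which is 0, makes each summand a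
      multiple of \<open>(x - Const c) * q c - 1\<close>.\<close>
    also have "\<dots> = (\<Sum>c\<in>C. Const (\<alpha> c) * Y c) - X * (\<Sum>c\<in>C. Const (\<alpha> c) * q c)"
      by (simp add: rel)
    also have "\<dots> = (\<Sum>c\<in>C. Const (\<alpha> c) * Y c - X * (Const (\<alpha> c) * q c))"
      by (simp add: sum_distrib_left sum_subtractf)
    also have "\<dots> = (\<Sum>c\<in>C. - (Const (\<alpha> c) * Y c) * ((x - Const c) * q c - 1))"
    proof (rule sum.cong)
      fix c assume "c \<in> C"
      show "Const (\<alpha> c) * Y c - X * (Const (\<alpha> c) * q c) =
          - (Const (\<alpha> c) * Y c) * ((x - Const c) * q c - 1)"
        unfolding X[OF \<open>c \<in> C\<close>] by (simp add: algebra_simps)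
    qed simp
    also have "\<dots> \<in> I" using q I by (intro is_ideal_sum is_idealD(3))
    finally show ?thesis .
  qed
  ultimately show False using one_in_ideal_of_eval_poly_at[OF I inv] \<open>1 \<notin> I\<close> by blast
qed

text \<open>No maximal ideal is required: the finitely many variables are made congruent to
  constants one at a time while 1 stays outside. Every \<open>f\<close> is then congruent to its
  value at the resulting point, and a proper ideal contains no nonzero constant.\<close>

lemma ex_point_of_proper_ideal:
  fixes I :: "('v::finite) mpoly set"
  assumes I: "is_ideal I" and "1 \<notin> I"
  shows "\<exists>p. \<forall>f\<in>I. eval_mpoly f p = 0"
proof -
  have "\<exists>J p. is_ideal J \<and> I \<subseteq> J \<and> 1 \<notin> J \<and> (\<forall>v\<in>A. Var v - Const (p v) \<in> J)" if "finite A" for A :: "'v set"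
    using that
  proof (induction A rule: finite_induct)
    case empty
    then show ?case using assms by auto
  next
    case (insert v A)
    then obtain J p where J: "is_ideal J" "I \<subseteq> J" "1 \<notin> J" "\<forall>v\<in>A. Var v - Const (p v) \<in> J"
      by blast
    obtain c where c: "1 \<notin> adjoin J (Var v - Const c)" using ex_proper_adjoin[OF J(1,3)] by blast
    have "\<forall>w\<in>insert v A. Var w - Const ((p(v := c)) w) \<in> adjoin J (Var v - Const c)"
      using J(4) adjoin(2,3)[OF J(1)] insert.hyps by auto
    then show ?case using c adjoin(1,2)[OF J(1)] J(2) by blast
  qed
  from this[of UNIV] obtain J p
    where J: "is_ideal J" "I \<subseteq> J" "1 \<notin> J" and p: "\<And>v. Var v - Const (p v) \<in> J" by auto
  define P :: "complex ^ 'v" where "P = (\<chi> v. p v)"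
  have "f - Const (eval_mpoly f P) \<in> J" for f
  proof (induction f rule: mpoly_ring_induct)
    case (add f g)
    have "f + g - Const (eval_mpoly (f + g) P) =
      (f - Const (eval_mpoly f P)) + (g - Const (eval_mpoly g P))"
      by (simp add: single_add)
    then show ?case using add is_idealD(2)[OF J(1)] by metis
  next
    case (mult f g)
    have "f * g - Const (eval_mpoly (f * g) P) =
      (f - Const (eval_mpoly f P)) * g + Const (eval_mpoly f P) * (g - Const (eval_mpoly g P))"
      by (simp add: algebra_simps mult_single)
    then show ?case using mult is_idealD[OF J(1)] by metis
  qed (simp_all add: is_idealD[OF J(1)] p P_def)
  then have "Const (eval_mpoly f P) \<in> J" if "f \<in> I" for f
    using that J(2) is_idealD(6)[OF J(1), of f "f - Const (eval_mpoly f P)"] by auto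
  moreover have "Const c \<notin> J" if "c \<noteq> 0" for c
    using is_idealD(3)[OF J(1), of "Const c" "Const (1 / c)"] J(3) that by (auto simp: mult_single)
  ultimately show ?thesis by blast
qed


subsection \<open>Homogeneous components\<close>

definition hcomp :: "nat \<Rightarrow> ('v::finite) mpoly \<Rightarrow> 'v mpoly" where
  "hcomp d p = Poly_Mapping.mapp (\<lambda>m c. c when (\<Sum>i\<in>UNIV. lookup m i) = d) p"

lemma lookup_hcomp: "lookup (hcomp d p) m = (lookup p m when (\<Sum>i\<in>UNIV. lookup m i) = d)"
  by (auto simp: hcomp_def lookup_mapp when_def in_keys_iff)

lemma hcomp_add: "hcomp d (p + q) = hcomp d p + hcomp d q"
  by (intro poly_mapping_eqI) (simp add: lookup_hcomp lookup_add when_def)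

lemma hcomp_diff: "hcomp d (p - q) = hcomp d p - hcomp d q"
  by (intro poly_mapping_eqI) (simp add: lookup_hcomp lookup_minus when_def)

lemma hcomp_zero [simp]: "hcomp d 0 = 0"
  by (intro poly_mapping_eqI) (simp add: lookup_hcomp)

lemma hcomp_sum: "hcomp d (\<Sum>i\<in>A. p i) = (\<Sum>i\<in>A. hcomp d (p i))"
  by (induction A rule: infinite_finite_induct) (simp_all add: hcomp_add)

lemma hcomp_homogeneous: "homogeneous d' p \<Longrightarrow> hcomp d p = (if d = d' then p else 0)"
  by (intro poly_mapping_eqI) (auto simp: lookup_hcomp homogeneous_def when_def in_keys_iff)

lemma hcomp_mult_homogeneous:
  assumes "homogeneous e h"
  shows "hcomp d (p * h) = (if e \<le> d then hcomp (d - e) p * h else 0)"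
proof (induction p rule: mpoly_induct)
  case (add p m c)
  define k where "k = (\<Sum>i\<in>UNIV. lookup m i)"
  have "homogeneous k (single m c)" by (simp add: homogeneous_def k_def)
  then have "hcomp d (single m c * h) = (if e \<le> d then hcomp (d - e) (single m c) * h else 0)"
    using homogeneous_mult[OF _ assms, of k "single m c"] by (auto simp: hcomp_homogeneous)
  then show ?case using add by (auto simp: hcomp_add algebra_simps)
qed simp

lemma hcomp_eventually_zero: "\<exists>d. hcomp d p = 0"
proof -
  have "finite ((\<lambda>m. \<Sum>i\<in>UNIV. lookup m i) ` keys p)" by simp
  then obtain d where "d \<notin> (\<lambda>m. \<Sum>i\<in>UNIV. lookup m i) ` keys p"
    using ex_new_if_finite[OF infinite_UNIV_nat] by blast
  then have "hcomp d p = 0"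
    by (intro poly_mapping_eqI) (auto simp: lookup_hcomp when_def in_keys_iff)
  then show ?thesis by blast
qed

lemma hcomp_combos:
  assumes "\<And>i. homogeneous e (h i)" "p \<in> combos h"
  shows "hcomp d p \<in> combos h"
proof -
  obtain c where "p = (\<Sum>i\<in>UNIV. c i * h i)" using assms(2) by (auto simp: combos_def)
  then have "hcomp d p = (\<Sum>i\<in>UNIV. if e \<le> d then hcomp (d - e) (c i) * h i else 0)"
    by (simp add: hcomp_sum hcomp_mult_homogeneous[OF assms(1)])
  also have "\<dots> \<in> combos h"
    by (intro is_ideal_sum is_ideal_combos) (auto simp: combos_mult is_idealD[OF is_ideal_combos])
  finally show ?thesis .
qed

text \<open>The only common zero is the origin, which is not on the hyperplane
  \<open>x_j = 1\<close>; so adjoining \<open>x_j - 1\<close> gives the unit ideal. The graded parts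
  of \<open>1 = a + (x_j - 1) q\<close> telescope, and a degree in which \<open>q\<close> has no
  part yields the power.\<close>

lemma Var_power_in_combos:
  fixes h :: "'i::finite \<Rightarrow> ('v::finite) mpoly"
  assumes hom: "\<And>i. homogeneous e (h i)"
    and zero: "\<And>p. (\<And>i. eval_mpoly (h i) p = 0) \<Longrightarrow> p = 0"
  shows "\<exists>N. Var j ^ N \<in> combos h"
proof -
  note I = is_idealD[OF is_ideal_combos[of h]]
  have "1 \<in> adjoin (combos h) (Var j - 1)"
  proof (rule ccontr)
    assume "1 \<notin> adjoin (combos h) (Var j - 1)"
    then obtain p where p: "\<forall>f\<in>adjoin (combos h) (Var j - 1). eval_mpoly f p = 0"
      using ex_point_of_proper_ideal adjoin(1)[OF is_ideal_combos] by blast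
    then have "eval_mpoly (h i) p = 0" for i
      using adjoin(2)[OF is_ideal_combos, of h "Var j - 1"] combos_member[of h i] by blast
    then have "p = 0" by (rule zero)
    moreover have "eval_mpoly (Var j - 1) p = 0" using p adjoin(3)[OF is_ideal_combos] by blast
    ultimately show False by simp
  qed
  then obtain a q where aq: "a \<in> combos h" "1 = a + (Var j - 1) * q" by (auto simp: adjoin_def)
  have a: "a = 1 - q * Var j + q" using aq(2) by (simp add: algebra_simps)
  have one: "hcomp d (1::'v mpoly) = (if d = 0 then 1 else 0)" for d
    using hcomp_homogeneous[of 0 "1::'v mpoly" d] by (simp add: homogeneous_def)
  have a_d: "hcomp d a = hcomp d 1 - (if 1 \<le> d then hcomp (d - 1) q * Var j else 0) + hcomp d q" for d
    unfolding a hcomp_add hcomp_diff hcomp_mult_homogeneous[OF homogeneous_Var] ..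
  have mem: "Var j ^ d + hcomp d q \<in> combos h" for d
  proof (induction d)
    case 0
    have "hcomp 0 a = 1 + hcomp 0 q" by (simp add: a_d one)
    then show ?case using hcomp_combos[OF hom aq(1), of 0] by simp
  next
    case (Suc d)
    have "Var j ^ Suc d + hcomp (Suc d) q = hcomp (Suc d) a + Var j * (Var j ^ d + hcomp d q)"
      by (simp add: a_d one algebra_simps)
    then show ?case using Suc I hcomp_combos[OF hom aq(1)] by metis
  qed
  obtain d where "hcomp d q = 0" using hcomp_eventually_zero by blast
  then show ?thesis using mem[of d] by auto
qed

section \<open>Koszul complex\<close>

text \<open>An alternating form is encoded by its coefficients on index lists, one function covering
  all degrees. Vanishing on repeated indices is not imposed; it follows for polynomials because 2 is
  invertible.\<close>

definition alternating :: "('i list \<Rightarrow> 'a::comm_ring_1) \<Rightarrow> bool" where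
  "alternating \<omega> \<longleftrightarrow> (\<forall>ps x y qs. \<omega> (ps @ x # y # qs) = - \<omega> (ps @ y # x # qs))"

lemma alternatingD: "alternating \<omega> \<Longrightarrow> \<omega> (ps @ x # y # qs) = - \<omega> (ps @ y # x # qs)"
  unfolding alternating_def by blast

lemma alternating_Cons:
  assumes "alternating \<omega>"
  shows "alternating (\<lambda>xs. \<omega> (x # xs))"
  unfolding alternating_def
proof (intro allI)
  fix ps y z qs
  show "\<omega> (x # ps @ y # z # qs) = - \<omega> (x # ps @ z # y # qs)"
    using alternatingD[OF assms, of "x # ps" y z qs] unfolding append_Cons .
qed

lemma mpoly_eq_uminus_self:
  fixes p :: "'v mpoly"
  assumes "p = - p"
  shows "p = 0"
proof (rule poly_mapping_eqI)
  fix m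
  have "lookup p m = - lookup p m" by (metis assms lookup_uminus)
  then show "lookup p m = lookup 0 m" by simp
qed

text \<open>The first of two equal entries is moved to the right until both are adjacent; swapping
  them then gives a value equal to its negative.\<close>

lemma alternating_not_distinct:
  fixes \<omega> :: "'i list \<Rightarrow> 'v mpoly"
  assumes "alternating \<omega>" "\<not> distinct xs"
  shows "\<omega> xs = 0"
proof -
  obtain as bs cs x where "xs = as @ [x] @ bs @ [x] @ cs"
    using not_distinct_decomp[OF assms(2)] by blast
  moreover have "\<omega> (as @ [x] @ bs @ [x] @ cs) = 0"
  proof (induction bs arbitrary: as)
    case Nil
    show ?case using mpoly_eq_uminus_self[OF alternatingD[OF assms(1)]] by simp
  next
    case (Cons b bs)
    have "\<omega> (as @ x # b # (bs @ x # cs)) = - \<omega> (as @ b # x # (bs @ x # cs))"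
      by (rule alternatingD[OF assms(1)])
    then show ?case using Cons.IH[of "as @ [b]"] by simp
  qed
  ultimately show ?thesis by simp
qed

definition koszul_diff :: "('i::finite \<Rightarrow> 'a::comm_ring_1) \<Rightarrow> ('i list \<Rightarrow> 'a) \<Rightarrow> 'i list \<Rightarrow> 'a" where
  "koszul_diff h \<omega> js = (\<Sum>i\<in>UNIV. h i * \<omega> (i # js))"

text \<open>Exterior multiplication by the 1-form \<open>c\<close> on the left. The recursion is the
  antiderivation rule for contraction with the basis direction \<open>x\<close>, which produces the
  minus sign.\<close>

fun wedge :: "('i \<Rightarrow> 'a::comm_ring_1) \<Rightarrow> ('i list \<Rightarrow> 'a) \<Rightarrow> 'i list \<Rightarrow> 'a" where
  "wedge c \<omega> [] = 0"
| "wedge c \<omega> (x # xs) = c x * \<omega> xs - wedge c (\<lambda>ys. \<omega> (x # ys)) xs"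

lemma wedge_sum:
  "wedge c (\<lambda>ys. \<Sum>i\<in>A. h i * \<omega> i ys) js = (\<Sum>i\<in>A. h i * wedge c (\<omega> i) js)"
  by (induction js arbitrary: \<omega>) (simp_all add: sum_distrib_left sum_subtractf algebra_simps)

lemma wedge_uminus: "wedge c (\<lambda>ys. - \<omega> ys) js = - wedge c \<omega> js"
  by (induction js arbitrary: \<omega>) simp_all

text \<open>Summing the recursion of \<open>wedge\<close> with weights \<open>h i\<close> gives the
  homotopy formula: \<open>wedge c\<close> contracts multiplication by any element
  \<open>\<Sum>i. c i * h i\<close> of the ideal.\<close>

lemma koszul_diff_wedge:
  "koszul_diff h (wedge c \<omega>) js = (\<Sum>i\<in>UNIV. c i * h i) * \<omega> js - wedge c (koszul_diff h \<omega>) js"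
proof -
  have "wedge c (koszul_diff h \<omega>) js = (\<Sum>i\<in>UNIV. h i * wedge c (\<lambda>ys. \<omega> (i # ys)) js)"
    unfolding koszul_diff_def[abs_def] by (rule wedge_sum)
  then show ?thesis
    by (simp add: koszul_diff_def sum_distrib_left right_diff_distrib sum_subtractf mult_ac)
qed

lemma alternating_wedge: "alternating \<omega> \<Longrightarrow> alternating (wedge c \<omega>)"
proof -
  have "wedge c \<omega> (ps @ x # y # qs) = - wedge c \<omega> (ps @ y # x # qs)" if "alternating \<omega>" for ps x y qs
    using that
  proof (induction ps arbitrary: \<omega>)
    case Nil
    have "(\<lambda>ys. \<omega> (x # y # ys)) = (\<lambda>ys. - \<omega> (y # x # ys))"
      by (intro ext) (rule alternatingD[OF Nil, of "[]", unfolded append_Nil])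
    then show ?case by (simp add: wedge_uminus)
  next
    case (Cons p ps)
    show ?case
      using Cons.IH[OF alternating_Cons[OF Cons.prems]] alternatingD[OF Cons.prems, of ps x y qs] by simp
  qed
  then show "alternating \<omega> \<Longrightarrow> alternating (wedge c \<omega>)" unfolding alternating_def[of "wedge c \<omega>"] by blast
qed

lemma alternating_koszul_diff:
  assumes "alternating \<omega>"
  shows "alternating (koszul_diff h \<omega>)"
  unfolding alternating_def
proof (intro allI)
  fix ps x y qs
  have "\<omega> (i # ps @ x # y # qs) = - \<omega> (i # ps @ y # x # qs)" for i
    using alternatingD[OF assms, of "i # ps" x y qs] unfolding append_Cons .
  then show "koszul_diff h \<omega> (ps @ x # y # qs) = - koszul_diff h \<omega> (ps @ y # x # qs)"
    by (simp add: koszul_diff_def sum_negf)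
qed

lemma koszul_diff_koszul_diff:
  fixes \<omega> :: "'i::finite list \<Rightarrow> 'v mpoly"
  assumes "alternating \<omega>"
  shows "koszul_diff h (koszul_diff h \<omega>) js = 0"
proof -
  define s where "s = koszul_diff h (koszul_diff h \<omega>) js"
  have "s = (\<Sum>i\<in>UNIV. \<Sum>j\<in>UNIV. h i * h j * \<omega> (j # i # js))"
    by (simp add: s_def koszul_diff_def sum_distrib_left mult.assoc)
  also have "\<dots> = (\<Sum>i\<in>UNIV. \<Sum>j\<in>UNIV. - (h j * h i * \<omega> (i # j # js)))"
    by (intro sum.cong refl, subst alternatingD[OF assms, of "[]", unfolded append_Nil])
       (simp add: mult.commute)
  also have "\<dots> = - (\<Sum>j\<in>UNIV. \<Sum>i\<in>UNIV. h j * h i * \<omega> (i # j # js))"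
    by (subst sum.swap) (simp add: sum_negf)
  also have "\<dots> = - s"
    by (simp add: s_def koszul_diff_def sum_distrib_left mult.assoc)
  finally show ?thesis unfolding s_def by (rule mpoly_eq_uminus_self)
qed

text \<open>The ideal generated by the powers \<open>x_i ^ N i\<close>, \<open>i \<in> K\<close>.\<close>

definition power_ideal :: "('v \<Rightarrow> nat) \<Rightarrow> 'v set \<Rightarrow> 'v mpoly set" where
  "power_ideal N K = {p. \<forall>m\<in>keys p. \<exists>i\<in>K. N i \<le> lookup m i}"

lemma is_ideal_power_ideal: "is_ideal (power_ideal N K)"
proof -
  have "p + q \<in> power_ideal N K" if "p \<in> power_ideal N K" "q \<in> power_ideal N K" for p q
    using that keys_add[of p q] by (auto simp: power_ideal_def)
  moreover have "r * p \<in> power_ideal N K" if p: "p \<in> power_ideal N K" for p r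
    unfolding power_ideal_def
  proof (rule CollectI, rule ballI)
    fix m assume "m \<in> keys (r * p)"
    then obtain a b where "m = a + b" "b \<in> keys p" using keys_mult[of r p] by auto
    then obtain i where "i \<in> K" "N i \<le> lookup b i" using p by (auto simp: power_ideal_def)
    then show "\<exists>i\<in>K. N i \<le> lookup m i"
      using \<open>m = a + b\<close> by (auto simp: lookup_add intro!: bexI[of _ i])
  qed
  moreover have "0 \<in> power_ideal N K" by (simp add: power_ideal_def)
  ultimately show ?thesis unfolding is_ideal_def by blast
qed

lemma power_ideal_mono: "K \<subseteq> K' \<Longrightarrow> power_ideal N K \<subseteq> power_ideal N K'"
  unfolding power_ideal_def by blast

lemma Var_power_in_power_ideal: "k \<in> K \<Longrightarrow> Var k ^ N k \<in> power_ideal N K"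
  by (auto simp: power_ideal_def Var_power intro: bexI[of _ k])

text \<open>Multiplying by a power of \<open>x_k\<close> changes no exponent with index in
  \<open>K\<close>, and only those decide membership.\<close>

lemma power_ideal_regular:
  assumes "k \<notin> K" "Var k ^ N k * p \<in> power_ideal N K"
  shows "p \<in> power_ideal N K"
  unfolding power_ideal_def
proof (rule CollectI, rule ballI)
  fix m assume "m \<in> keys p"
  then have "single k (N k) + m \<in> keys (Var k ^ N k * p)"
    using lookup_single_mult[of "single k (N k)" 1 p m] by (simp add: Var_power in_keys_iff)
  then obtain i where i: "i \<in> K" "N i \<le> lookup (single k (N k) + m) i"
    using assms(2) by (auto simp: power_ideal_def)
  then have "i \<noteq> k" using assms(1) by auto
  then show "\<exists>i\<in>K. N i \<le> lookup m i" using i by (auto simp: lookup_add lookup_single)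
qed

text \<open>Division by \<open>x_k ^ n\<close> in which monomials not divisible by it are dropped.
  Being additive, unlike a chosen quotient, it keeps alternating families alternating.\<close>

definition quot :: "'v \<Rightarrow> nat \<Rightarrow> 'v mpoly \<Rightarrow> 'v mpoly" where
  "quot k n p = Poly_Mapping.map_key (\<lambda>m. single k n + m) p"

lemma lookup_quot: "lookup (quot k n p) m = lookup p (single k n + m)"
  by (simp add: quot_def Poly_Mapping.map_key.rep_eq inj_on_def)

lemma quot_uminus: "quot k n (- p) = - quot k n p"
  by (intro poly_mapping_eqI) (simp add: lookup_quot)

lemma diff_quot_in_power_ideal:
  assumes "p \<in> power_ideal N (insert k K)"
  shows "p - Var k ^ N k * quot k (N k) p \<in> power_ideal N K"
  unfolding power_ideal_def
proof (rule CollectI, rule ballI)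
  fix m assume m: "m \<in> keys (p - Var k ^ N k * quot k (N k) p)"
  have *: "lookup (Var k ^ N k * quot k (N k) p) (single k (N k) + m') = lookup p (single k (N k) + m')" for m'
    using lookup_single_mult[of "single k (N k)" 1 "quot k (N k) p" m'] by (simp add: Var_power lookup_quot)
  have "\<not> N k \<le> lookup m k"
  proof
    assume "N k \<le> lookup m k"
    then show False using *[of "m - single k (N k)"] add_single_diff(1)[of "N k" m k] m
      by (simp add: in_keys_iff lookup_minus)
  qed
  moreover have "m \<notin> keys (Var k ^ N k * quot k (N k) p)"
  proof
    assume "m \<in> keys (Var k ^ N k * quot k (N k) p)"
    then obtain b where "m = single k (N k) + b"
      using keys_mult[of "Var k ^ N k" "quot k (N k) p"] by (auto simp: Var_power)
    then show False using \<open>\<not> N k \<le> lookup m k\<close> by (simp add: lookup_add)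
  qed
  ultimately show "\<exists>i\<in>K. N i \<le> lookup m i"
    using m assms by (auto simp: power_ideal_def in_keys_iff lookup_minus)
qed

text \<open>
  Vanishing of \<open>H\<^sub>i\<^sub>+\<^sub>1\<close> of the Koszul complex modulo \<open>power_ideal N (insert k K)\<close> implies vanishing
  of \<open>H\<^sub>i\<close> modulo \<open>power_ideal N K\<close>, because multiplication by \<open>x_k ^ N k\<close> is homotopic to 0
  on the Koszul complex and injective modulo \<open>power_ideal N K\<close>.
\<close>

lemma koszul_exact_mod_power_ideal:
  fixes h :: "'v::finite \<Rightarrow> 'v mpoly"
  assumes "\<And>k. Var k ^ N k \<in> combos h"
    and "alternating \<omega>"
    and "\<And>js. length js = card K \<Longrightarrow> koszul_diff h \<omega> js \<in> power_ideal N K"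
  shows "\<exists>\<eta>. alternating \<eta> \<and>
    (\<forall>js. length js = Suc (card K) \<longrightarrow> \<omega> js - koszul_diff h \<eta> js \<in> power_ideal N K)"
  using assms(2,3)
\<comment> \<open>The degree \<open>Suc (card K)\<close> grows with \<open>K\<close>, so the
  induction bottoms out at \<open>K = UNIV\<close>, where lists are longer than the number of
  indices and an alternating form is 0.\<close>
proof (induction "card (- K)" arbitrary: K \<omega>)
  case 0
  then have "K = UNIV" by auto
  have "\<omega> js = 0" if "length js = Suc (card K)" for js
  proof (rule alternating_not_distinct[OF \<open>alternating \<omega>\<close>])
    have "card (set js) \<le> card (UNIV :: 'v set)" by (intro card_mono) auto
    then show "\<not> distinct js" using distinct_card[of js] that \<open>K = UNIV\<close> by auto
  qed
  then show ?case
    by (intro exI[of _ "\<lambda>_. 0"])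
       (simp add: alternating_def koszul_diff_def is_idealD[OF is_ideal_power_ideal])
next
  case (Suc n)
  note ideal = is_idealD[OF is_ideal_power_ideal]
  from Suc.hyps(2) have "- K \<noteq> {}" by (intro notI) simp
  then obtain k where k: "k \<notin> K" by blast
  define a where "a = Var k ^ N k"
  define K' where "K' = insert k K"
  have K': "card K' = Suc (card K)" "n = card (- K')" "power_ideal N K \<subseteq> power_ideal N K'"
    using k Suc.hyps(2) by (auto simp: K'_def Compl_insert card_Diff_singleton intro!: power_ideal_mono)
  have a: "a \<in> power_ideal N K'" unfolding a_def K'_def by (rule Var_power_in_power_ideal) simp
  obtain c where c: "a = (\<Sum>i\<in>UNIV. c i * h i)"
    using assms(1)[of k] by (auto simp: combos_def a_def)
  \<comment> \<open>By the homotopy formula \<open>koszul_diff h \<eta>\<close> agrees with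
    \<open>a * \<omega>\<close> modulo the smaller ideal. Since \<open>a\<close> lies in the larger
    one, \<open>\<eta>\<close> is a cycle modulo that, one degree higher.\<close>
  define \<eta> where "\<eta> = wedge c \<omega>"
  have wedge_mem: "wedge c \<phi> js \<in> power_ideal N K"
    if "\<And>js. length js = l \<Longrightarrow> \<phi> js \<in> power_ideal N K" "length js = Suc l" for \<phi> l js
    using that
  proof (induction js arbitrary: l \<phi>)
    case (Cons x js)
    have "wedge c (\<lambda>ys. \<phi> (x # ys)) js \<in> power_ideal N K"
    proof (cases l)
      case (Suc l')
      then show ?thesis using Cons.prems by (intro Cons.IH[of l']) auto
    qed (use Cons.prems ideal in auto)
    then show ?case using Cons.prems by (simp add: ideal)
  qed simp
  have \<eta>: "a * \<omega> js - koszul_diff h \<eta> js \<in> power_ideal N K" if "length js = Suc (card K)" for js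
    using wedge_mem[of "card K" "koszul_diff h \<omega>" js] Suc.prems(2) that
    by (simp add: \<eta>_def koszul_diff_wedge c)
  have "koszul_diff h \<eta> js \<in> power_ideal N K'" if "length js = card K'" for js
  proof -
    have "koszul_diff h \<eta> js = \<omega> js * a - (a * \<omega> js - koszul_diff h \<eta> js)" by simp
    then show ?thesis using \<eta>[of js] that K' a ideal by (metis subsetD)
  qed
  moreover have "alternating \<eta>" unfolding \<eta>_def using Suc.prems(1) by (rule alternating_wedge)
  ultimately obtain \<theta> where \<theta>: "alternating \<theta>"
    "\<And>js. length js = Suc (card K') \<Longrightarrow> \<eta> js - koszul_diff h \<theta> js \<in> power_ideal N K'"
    using Suc.hyps(1)[OF K'(2), of \<eta>] by blast
  \<comment> \<open>In the relevant degree \<open>\<eta> - koszul_diff h \<theta>\<close> is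
    congruent to \<open>a * \<zeta>\<close> modulo \<open>power_ideal N K\<close>; applying the
    differential removes \<open>\<theta>\<close>.\<close>
  define \<zeta> where "\<zeta> js = quot k (N k) (\<eta> js - koszul_diff h \<theta> js)" for js
  have "alternating \<zeta>"
    unfolding alternating_def
  proof (intro allI)
    fix ps x y qs
    have "\<eta> (ps @ x # y # qs) - koszul_diff h \<theta> (ps @ x # y # qs) =
        - (\<eta> (ps @ y # x # qs) - koszul_diff h \<theta> (ps @ y # x # qs))"
      using alternatingD[OF \<open>alternating \<eta>\<close>, of ps x y qs]
        alternatingD[OF alternating_koszul_diff[OF \<theta>(1)], of h ps x y qs] by simp
    then show "\<zeta> (ps @ x # y # qs) = - \<zeta> (ps @ y # x # qs)"
      unfolding \<zeta>_def by (simp only: quot_uminus)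
  qed
  moreover have "\<omega> js - koszul_diff h \<zeta> js \<in> power_ideal N K" if js: "length js = Suc (card K)" for js
  proof -
    have "\<eta> (i # js) - koszul_diff h \<theta> (i # js) - a * \<zeta> (i # js) \<in> power_ideal N K" for i
      unfolding a_def \<zeta>_def using \<theta>(2)[of "i # js"] js K'
      by (intro diff_quot_in_power_ideal) (simp add: K'_def)
    then have "(\<Sum>i\<in>UNIV. h i * (\<eta> (i # js) - koszul_diff h \<theta> (i # js) - a * \<zeta> (i # js)))
        \<in> power_ideal N K"
      by (intro is_ideal_sum is_ideal_power_ideal ideal(3))
    also have "(\<Sum>i\<in>UNIV. h i * (\<eta> (i # js) - koszul_diff h \<theta> (i # js) - a * \<zeta> (i # js))) =
        koszul_diff h \<eta> js - koszul_diff h (koszul_diff h \<theta>) js - a * koszul_diff h \<zeta> js"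
      by (simp add: koszul_diff_def[of h _ js] right_diff_distrib sum_subtractf sum_distrib_left mult.left_commute)
    finally have "koszul_diff h \<eta> js - a * koszul_diff h \<zeta> js \<in> power_ideal N K"
      by (simp add: koszul_diff_koszul_diff[OF \<theta>(1)])
    \<comment> \<open>Adding the congruences of \<open>koszul_diff h \<eta>\<close> with
      \<open>a * \<omega>\<close> and with \<open>a * koszul_diff h \<zeta>\<close> leaves a
      multiple of \<open>a\<close>, which is a nonzerodivisor modulo the ideal.\<close>
    from ideal(2)[OF \<eta>[OF js] this] have "a * (\<omega> js - koszul_diff h \<zeta> js) \<in> power_ideal N K"
      by (simp add: algebra_simps)
    then show ?thesis unfolding a_def by (rule power_ideal_regular[OF k])
  qed
  ultimately show ?case by blast
qed

text \<open>This is exactness for \<open>K = {}\<close>, where the monomial ideal is 0: a syzygy is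
  a cycle of degree 1, hence the boundary of a 2-form.\<close>

lemma koszul_syzygies:
  fixes h :: "'v::finite \<Rightarrow> 'v mpoly"
  assumes hom: "\<And>i. homogeneous e (h i)"
    and zero: "\<And>p. (\<And>i. eval_mpoly (h i) p = 0) \<Longrightarrow> p = 0"
    and syz: "(\<Sum>i\<in>UNIV. b i * h i) = 0"
  shows "\<exists>\<eta>. (\<forall>i j. \<eta> i j = - \<eta> j i) \<and> (\<forall>j. b j = (\<Sum>i\<in>UNIV. h i * \<eta> i j))"
proof -
  have "\<exists>N. Var k ^ N \<in> combos h" for k by (rule Var_power_in_combos) (fact hom zero)+
  then obtain N where N: "\<And>k. Var k ^ N k \<in> combos h" by metis
  \<comment> \<open>A list with two adjacent entries has length at least 2, so extending the 1-form
    by 0 makes alternation automatic.\<close>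
  define \<omega> where "\<omega> js = (if length js = 1 then b (hd js) else 0)" for js
  have ideal: "power_ideal N {} = {0}" by (auto simp: power_ideal_def)
  have "alternating \<omega>" by (simp add: alternating_def \<omega>_def)
  moreover have "koszul_diff h \<omega> js \<in> power_ideal N {}" if "length js = card {}" for js
    using that syz by (simp add: ideal koszul_diff_def \<omega>_def mult.commute)
  ultimately obtain \<eta> where \<eta>: "alternating \<eta>"
    "\<And>js. length js = 1 \<Longrightarrow> \<omega> js - koszul_diff h \<eta> js = 0"
    using koszul_exact_mod_power_ideal[OF N, of \<omega> "{}"] by (auto simp: ideal)
  have "b j = (\<Sum>i\<in>UNIV. h i * \<eta> [i, j])" for j
    using \<eta>(2)[of "[j]"] by (simp add: \<omega>_def koszul_diff_def)
  moreover have "\<eta> [i, j] = - \<eta> [j, i]" for i j using alternatingD[OF \<eta>(1), of "[]" i j "[]"] by simp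
  ultimately show ?thesis by (intro exI[of _ "\<lambda>i j. \<eta> [i, j]"] conjI allI)
qed

section \<open>Common zeros of the polynomials \<open>g'\<close> under the normal crossing condition\<close>

lemma eval_mpoly_line_deriv:
  fixes x w :: "complex ^ ('v::finite)"
  shows "((\<lambda>t. eval_mpoly p (x + t *s w)) has_field_derivative
           (\<Sum>i\<in>UNIV. eval_mpoly (partial_deriv i p) x * w $ i)) (at 0)"
proof (induction p rule: mpoly_ring_induct)
  case (Const c)
  have "partial_deriv i (Const c) = 0" for i :: 'v by (simp add: partial_deriv_single)
  then show ?case by simp
next
  case (Var v)
  have "(\<Sum>i\<in>UNIV. eval_mpoly (partial_deriv i (Var v)) x * w $ i) = (\<Sum>i\<in>UNIV. if i = v then w $ i else 0)"
    by (intro sum.cong) (auto simp: partial_deriv_Var)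
  moreover have "((\<lambda>t. x $ v + t * w $ v) has_field_derivative w $ v) (at 0)"
    by (auto intro!: derivative_eq_intros)
  ultimately show ?case by simp
next
  case (add p q)
  show ?case using DERIV_add[OF add] by (simp add: algebra_simps sum.distrib)
next
  case (mult p q)
  show ?case using DERIV_mult[OF mult]
    by (simp add: partial_deriv_mult algebra_simps sum.distrib sum_distrib_left)
qed

section \<open>Differentials of holomorphic functions and of local coordinates\<close>

lemma bounded_linear_scale_vec: "bounded_linear (\<lambda>t. t *s (v :: complex ^ 'n))"
  by (intro linear_conv_bounded_linear[THEN iffD1] linearI)
     (simp_all add: vec_eq_iff algebra_simps scaleR_conv_of_real[where ?'a = complex])

lemma complex_line_deriv:
  fixes h :: "complex ^ 'n \<Rightarrow> complex"
  assumes "(h has_derivative L) (at a)" "\<And>c v. L (c *s v) = c * L v"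
  shows "((\<lambda>t. h (a + t *s v)) has_field_derivative L v) (at 0)"
proof -
  have "((\<lambda>t. a + t *s v) has_derivative (\<lambda>t. t *s v)) (at 0)"
    using has_derivative_add[OF has_derivative_const[of a]
        bounded_linear.has_derivative[OF bounded_linear_scale_vec has_derivative_ident]]
    by simp
  then have "((\<lambda>t. h (a + t *s v)) has_derivative (\<lambda>t. L (t *s v))) (at 0)"
    using assms(1) by (intro has_derivative_compose[of _ _ 0 UNIV h]) simp_all
  moreover have "(\<lambda>t. L (t *s v)) = (*) (L v)" by (simp add: assms(2) fun_eq_iff)
  ultimately show ?thesis by (simp add: has_field_derivative_def)
qed

lemma has_derivative_vec:
  fixes h :: "'a::real_normed_vector \<Rightarrow> complex ^ 'n"
  assumes "\<And>i. ((\<lambda>z. h z $ i) has_derivative L i) F"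
  shows "(h has_derivative (\<lambda>v. \<chi> i. L i v)) F"
proof -
  have "bounded_linear (\<lambda>c. axis i c :: complex ^ 'n)" for i :: 'n
    by (intro linear_conv_bounded_linear[THEN iffD1] linearI) (simp_all add: vec_eq_iff axis_def)
  then have "((\<lambda>z. \<Sum>i\<in>UNIV. axis i (h z $ i)) has_derivative (\<lambda>v. \<Sum>i\<in>UNIV. axis i (L i v))) F"
    by (intro has_derivative_sum) (rule bounded_linear.has_derivative[OF _ assms])
  moreover have "(\<Sum>i\<in>UNIV. axis i (x i)) = (\<chi> i. x i)" for x :: "'n \<Rightarrow> complex"
    by (simp add: vec_eq_iff axis_def if_distrib[of "\<lambda>f. f $ _"] cong: if_cong)
  ultimately show ?thesis by simp
qed

text \<open>Surjectivity of the differential comes from differentiating \<open>y (z w) = w\<close>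
  at 0, where \<open>z\<close> is the local inverse.\<close>

lemma local_coordinates_deriv:
  fixes y :: "complex ^ 'n \<Rightarrow> complex ^ 'n"
  assumes "local_coordinates a U y"
  shows "\<exists>L. (\<forall>i. ((\<lambda>z. y z $ i) has_derivative L i) (at a)) \<and>
     (\<forall>i c v. L i (c *s v) = c * L i v) \<and> (\<forall>w. \<exists>v. \<forall>i. L i v = w i)"
proof -
  define z where "z = inv_into U y"
  have a: "a \<in> U" "y a = 0" "inj_on y U" "open (y ` U)"
    and y: "\<And>i. holomorphic_fun (\<lambda>z. y z $ i) U"
    and z: "\<And>i. holomorphic_fun (\<lambda>w. z w $ i) (y ` U)"
    using assms by (auto simp: local_coordinates_def holomorphic_map_def z_def)
  have "0 \<in> y ` U" using a by force
  have "z 0 = a" using a inv_into_f_f[of y U a] by (simp add: z_def)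
  have "\<exists>D. ((\<lambda>z. y z $ i) has_derivative D) (at a) \<and> (\<forall>c v. D (c *s v) = c * D v)" for i
    using y[of i] a(1) by (auto simp: holomorphic_fun_def)
  then obtain L where L: "\<And>i. ((\<lambda>z. y z $ i) has_derivative L i) (at a)"
    "\<And>i c v. L i (c *s v) = c * L i v" by metis
  have "\<exists>D. ((\<lambda>w. z w $ i) has_derivative D) (at 0)" for i
    using z[of i] \<open>0 \<in> y ` U\<close> unfolding holomorphic_fun_def by blast
  then obtain M where "\<And>i. ((\<lambda>w. z w $ i) has_derivative M i) (at 0)" by metis
  then have M: "(z has_derivative (\<lambda>w. \<chi> i. M i w)) (at 0)" by (rule has_derivative_vec)
  have "L i (\<chi> j. M j w) = w $ i" for i w
  proof -
    have "((\<lambda>w. y (z w) $ i) has_derivative (\<lambda>w. L i (\<chi> j. M j w))) (at 0)"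
      using M L(1)[of i] \<open>z 0 = a\<close> by (intro has_derivative_compose[of z _ 0 UNIV "\<lambda>z. y z $ i"]) simp_all
    then have "((\<lambda>w. w $ i) has_derivative (\<lambda>w. L i (\<chi> j. M j w))) (at 0)"
      by (rule has_derivative_transform_within_open[OF _ a(4) \<open>0 \<in> y ` U\<close>])
         (simp add: z_def f_inv_into_f)
    moreover have "((\<lambda>w. w $ i) has_derivative (\<lambda>w. w $ i)) (at (0 :: complex ^ 'n))"
      by (rule bounded_linear.has_derivative[OF bounded_linear_vec_nth has_derivative_ident])
    ultimately show ?thesis using has_derivative_unique by metis
  qed
  then have "\<exists>v. \<forall>i. L i v = w i" for w :: "'n \<Rightarrow> complex"
    by (intro exI[of _ "\<chi> j. M j (\<chi> i. w i)"]) simp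
  then show ?thesis using L by blast
qed

text \<open>The quotient by \<open>t ^ m\<close> is the quotient by \<open>t ^ n\<close> times a
  positive power of \<open>t\<close>. Thus two nonzero leading coefficients force equal orders of
  vanishing.\<close>

lemma limit_quotient_power_eq_0:
  fixes F :: "complex \<Rightarrow> complex"
  assumes "((\<lambda>t. F t / t ^ n) \<longlongrightarrow> Q) (at 0)" "((\<lambda>t. F t / t ^ m) \<longlongrightarrow> P) (at 0)" "m < n"
  shows "P = 0"
proof -
  have "((\<lambda>t. t ^ (n - m)) \<longlongrightarrow> 0 ^ (n - m)) (at (0::complex))" by (intro tendsto_intros)
  then have "((\<lambda>t. F t / t ^ n * t ^ (n - m)) \<longlongrightarrow> Q * 0) (at 0)"
    using assms(1,3) by (intro tendsto_mult) (simp_all add: power_0_left)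
  moreover have "F t / t ^ n * t ^ (n - m) = F t / t ^ m" if "t \<noteq> 0" for t
    using assms(3) that by (simp add: field_simps flip: power_add)
  ultimately have "((\<lambda>t. F t / t ^ m) \<longlongrightarrow> 0) (at 0)"
    by (auto elim!: Lim_transform_eventually simp: eventually_at_filter)
  then show ?thesis using assms(2) tendsto_unique[OF trivial_limit_at] by blast
qed

text \<open>The differential of the affine map \<open>homogeneous_coords k\<close>; its image is the
  hyperplane where coordinate \<open>k\<close> is 0.\<close>

definition chart_direction :: "'n option \<Rightarrow> complex ^ ('n::finite) \<Rightarrow> complex ^ ('n option)" where
  "chart_direction k v = homogeneous_coords k v - homogeneous_coords k 0"

lemma chart_direction_nth:
  "chart_direction k v $ j = (if j = k then 0 else case j of None \<Rightarrow> v $ the k | Some i \<Rightarrow> v $ i)"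
  by (simp add: chart_direction_def homogeneous_coords_def split: option.split)

lemma homogeneous_coords_line:
  "homogeneous_coords k (a + t *s v) = homogeneous_coords k a + t *s chart_direction k v"
  by (auto simp: vec_eq_iff chart_direction_nth homogeneous_coords_def split: option.split)

lemma chart_direction_linear:
  "chart_direction k (v - w) = chart_direction k v - chart_direction k w"
  "chart_direction k (c *s v) = c *s chart_direction k v"
  "chart_direction k (\<Sum>i\<in>A. f i) = (\<Sum>i\<in>A. chart_direction k (f i))"
proof -
  have "chart_direction k (v + w) = chart_direction k v + chart_direction k w" for v w
    by (auto simp: vec_eq_iff chart_direction_nth split: option.split)
  moreover have "chart_direction k 0 = 0" by (simp add: chart_direction_def)
  ultimately show "chart_direction k (\<Sum>i\<in>A. f i) = (\<Sum>i\<in>A. chart_direction k (f i))"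
    by (induction A rule: infinite_finite_induct) simp_all
qed (auto simp: vec_eq_iff chart_direction_nth split: option.split)

lemma chart_direction_surj:
  assumes "w $ k = 0"
  shows "\<exists>v. chart_direction k v = w"
proof
  show "chart_direction k (affine_coords k (\<chi> j. if j = k then 1 else w $ j)) = w"
    using assms by (auto simp: vec_eq_iff chart_direction_nth affine_coords_def split: option.split)
qed

text \<open>
  At a common zero \<open>p\<close> of the \<open>g'\<close>, the differential of \<open>g\<close> is a combination of those \<open>dx_j\<close>
  with \<open>p_j = 0\<close>. Hence the leading form of \<open>f\<close> at \<open>p\<close> is a product of \<open>r\<close> linear
  forms that span a space of dimension \<open>< r\<close>, whereas the leading form of a normal crossing
  equation is a product of independent linear forms.
\<close>

lemma no_common_zero_of_g':
  fixes g f :: "(('n::finite) option) mpoly"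
  assumes hom: "homogeneous e g" and smooth: "smooth_hypersurface g"
    and f: "f = (\<Prod>i\<in>UNIV. Var i) * g" and nc: "normal_crossing_divisor f"
    and zero: "\<And>i. eval_mpoly (g' g i) p = 0"
  shows "p = 0"
proof (rule ccontr)
  assume "p \<noteq> 0"
  \<comment> \<open>This puts a common zero of the \<open>g'\<close> on \<open>g = 0\<close>, as
    \<open>e + CARD('n option)\<close> is nonzero in characteristic 0.\<close>
  have euler: "(\<Sum>i\<in>UNIV. g' g i) = of_nat (e + CARD('n option)) * g"
    by (simp add: g'_def sum.distrib euler_homogeneous[OF hom] algebra_simps)
  have "eval_mpoly (of_nat m) x = of_nat m" for m and x :: "complex ^ 'n option"
    using eval_Const[of "of_nat m" x] by simp
  then have "of_nat (e + CARD('n option)) * eval_mpoly g p = (\<Sum>i\<in>UNIV. eval_mpoly (g' g i) p)"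
    unfolding eval_sum[symmetric] euler eval_mult by simp
  moreover have "of_nat (e + CARD('n option)) \<noteq> (0 :: complex)"
    by (simp only: of_nat_eq_0_iff) simp
  ultimately have gp: "eval_mpoly g p = 0" using zero by (simp del: of_nat_add)
  then have "eval_mpoly f p = 0" by (simp add: f)
  then have "normal_crossing_at f p"
    using nc \<open>p \<noteq> 0\<close> by (auto simp: normal_crossing_divisor_def)
  then obtain k U y R u where k: "p $ k \<noteq> 0"
    and y: "local_coordinates (affine_coords k p) U y" and u: "holomorphic_fun u U"
    and fu: "\<And>z. z \<in> U \<Longrightarrow> u z \<noteq> 0"
      "\<And>z. z \<in> U \<Longrightarrow> eval_mpoly f (homogeneous_coords k z) = u z * (\<Prod>i\<in>R. y z $ i)"
    unfolding normal_crossing_at_def by blast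
  define a where "a = affine_coords k p"
  define q where "q = homogeneous_coords k a"
  have q: "q = (1 / p $ k) *s p" using homogeneous_affine_coords[OF k] by (simp add: q_def a_def)
  have "q $ k \<noteq> 0" using k by (simp add: q)
  then have "q \<noteq> 0" by auto
  have gq: "eval_mpoly g q = 0" unfolding q homogeneous_eval_scale[OF hom] using gp by simp
  have "eval_mpoly (g' g i) q = 0" for i
    unfolding q homogeneous_eval_scale[OF homogeneous_g'[OF hom]] using zero by simp
  then have grad: "q $ i * eval_mpoly (partial_deriv i g) q = 0" for i
    using gq by (simp add: g'_def)
  obtain j0 where j0: "eval_mpoly (partial_deriv j0 g) q \<noteq> 0"
    using smooth \<open>q \<noteq> 0\<close> gq by (auto simp: smooth_hypersurface_def)
  define J where "J = {j. q $ j = 0}"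
  have "j0 \<in> J" "k \<notin> J" using grad[of j0] j0 \<open>q $ k \<noteq> 0\<close> by (auto simp: J_def)
  obtain L where L: "\<And>i. ((\<lambda>z. y z $ i) has_derivative L i) (at a)"
    "\<And>i c v. L i (c *s v) = c * L i v" "\<And>w. \<exists>v. \<forall>i. L i v = w i"
    using local_coordinates_deriv[OF y] unfolding a_def by blast
  define F where "F v t = eval_mpoly f (homogeneous_coords k (a + t *s v))" for v t
  define l where "l w = (\<Sum>i\<in>UNIV. eval_mpoly (partial_deriv i g) q * w $ i)" for w
  define A where "A = (\<Prod>i\<in>-J. q $ i)"
  \<comment> \<open>Leading form from the product defining \<open>f\<close>: at \<open>q\<close> the
    \<open>x_i\<close> with \<open>i \<in> J\<close> and also \<open>g\<close> vanish, giving order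
    \<open>Suc (card J)\<close>, while \<open>A\<close> collects the coordinates that do not vanish.
    The form \<open>Q\<close> comes from the normal crossing equation, with order
    \<open>card R\<close>.\<close>
  define P where "P w = A * (\<Prod>i\<in>J. w $ i) * l w" for w
  define Q where "Q v = u a * (\<Prod>i\<in>R. L i v)" for v

  have limP: "((\<lambda>t. F v t / t ^ Suc (card J)) \<longlongrightarrow> P (chart_direction k v)) (at 0)" for v
  proof -
    define w where "w = chart_direction k v"
    have "((\<lambda>t. (\<Prod>i\<in>-J. q $ i + t * w $ i) * (\<Prod>i\<in>J. w $ i) * (eval_mpoly g (q + t *s w) / t))
        \<longlongrightarrow> (\<Prod>i\<in>-J. q $ i + 0 * w $ i) * (\<Prod>i\<in>J. w $ i) * l w) (at 0)"
      using eval_mpoly_line_deriv[of g q w] gq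
      by (intro tendsto_intros) (simp add: l_def DERIV_def)
    then have "((\<lambda>t. (\<Prod>i\<in>-J. q $ i + t * w $ i) * (\<Prod>i\<in>J. w $ i) * (eval_mpoly g (q + t *s w) / t))
        \<longlongrightarrow> P w) (at 0)" by (simp add: P_def A_def)
    moreover have "(\<Prod>i\<in>-J. q $ i + t * w $ i) * (\<Prod>i\<in>J. w $ i) * (eval_mpoly g (q + t *s w) / t)
        = F v t / t ^ Suc (card J)" if "t \<noteq> 0" for t
    proof -
      have "(\<Prod>i\<in>UNIV. (q + t *s w) $ i) =
          (\<Prod>i\<in>-J. (q + t *s w) $ i) * (\<Prod>i\<in>J. (q + t *s w) $ i)"
        using prod.subset_diff[of J UNIV "\<lambda>i. (q + t *s w) $ i"] by (simp add: Compl_eq_Diff_UNIV)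
      also have "(\<Prod>i\<in>J. (q + t *s w) $ i) = t ^ card J * (\<Prod>i\<in>J. w $ i)"
        by (simp add: J_def prod.distrib)
      finally have "F v t = (\<Prod>i\<in>-J. q $ i + t * w $ i) * (t ^ card J * (\<Prod>i\<in>J. w $ i)) *
          eval_mpoly g (q + t *s w)"
        by (simp add: F_def homogeneous_coords_line f w_def q_def)
      then show ?thesis using that by (simp add: field_simps)
    qed
    ultimately show ?thesis unfolding w_def[symmetric]
      by (auto elim!: Lim_transform_eventually simp: eventually_at_filter)
  qed

  have limQ: "((\<lambda>t. F v t / t ^ card R) \<longlongrightarrow> Q v) (at 0)" for v
  proof -
    have aU: "a \<in> U" "y a = 0" "open U"
      using y u by (auto simp: local_coordinates_def a_def holomorphic_fun_def)
    have line: "((\<lambda>t. a + t *s v) \<longlongrightarrow> a) (at 0)"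
    proof -
      have "((\<lambda>t. a + t *s v) \<longlongrightarrow> a + 0 *s v) (at 0)"
        by (intro tendsto_add tendsto_const bounded_linear.tendsto[OF bounded_linear_scale_vec]
            tendsto_ident_at)
      moreover have "a + 0 *s v = a" by (simp add: vec_eq_iff)
      ultimately show ?thesis by simp
    qed
    have "((\<lambda>t. y (a + t *s v) $ i / t) \<longlongrightarrow> L i v) (at 0)" for i
      using complex_line_deriv[OF L(1)[of i] L(2)[of i], of v] aU(2) by (simp add: DERIV_def)
    moreover
    have "isCont u a"
      using u aU(1) unfolding holomorphic_fun_def by (blast intro: has_derivative_continuous)
    then have "((\<lambda>t. u (a + t *s v)) \<longlongrightarrow> u a) (at 0)" using line by (rule isCont_tendsto_compose)
    ultimately have "((\<lambda>t. u (a + t *s v) * (\<Prod>i\<in>R. y (a + t *s v) $ i / t)) \<longlongrightarrow> Q v) (at 0)"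
      unfolding Q_def by (intro tendsto_intros)
    moreover have "\<forall>\<^sub>F t in at 0. a + t *s v \<in> U"
      using line aU by (rule_tac topological_tendstoD) auto
    then have "\<forall>\<^sub>F t in at 0. u (a + t *s v) * (\<Prod>i\<in>R. y (a + t *s v) $ i / t) = F v t / t ^ card R"
      by eventually_elim (simp add: F_def fu(2) prod_dividef)
    ultimately show ?thesis by (rule Lim_transform_eventually)
  qed

  obtain v0 where v0: "\<And>i. L i v0 = 1" using L(3)[of "\<lambda>_. 1"] by auto
  have "u a \<noteq> 0" using fu(1) y by (simp add: a_def local_coordinates_def)
  then have Q0: "Q v0 \<noteq> 0" by (simp add: Q_def v0)
  have "\<exists>v. P (chart_direction k v) \<noteq> 0"
  proof -
    \<comment> \<open>Along this family \<open>l\<close> is affine in \<open>s\<close> with nonzero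
      slope, the \<open>j0\<close>-th partial derivative at \<open>q\<close>, so it cannot vanish at
      both 1 and 2.\<close>
    define w :: "complex \<Rightarrow> complex ^ 'n option"
      where "w s = (\<chi> j. if j = j0 then s else if j \<in> J then 1 else 0)" for s
    define B where "B = (\<Sum>i\<in>UNIV - {j0}. eval_mpoly (partial_deriv i g) q * w 0 $ i)"
    have "l (w s) = eval_mpoly (partial_deriv j0 g) q * s + B" for s
    proof -
      have "l (w s) = eval_mpoly (partial_deriv j0 g) q * w s $ j0 +
          (\<Sum>i\<in>UNIV - {j0}. eval_mpoly (partial_deriv i g) q * w s $ i)"
        unfolding l_def by (rule sum.remove) auto
      also have "(\<Sum>i\<in>UNIV - {j0}. eval_mpoly (partial_deriv i g) q * w s $ i) = B"
        unfolding B_def by (intro sum.cong) (auto simp: w_def)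
      finally show ?thesis by (simp add: w_def)
    qed
    then have "l (w 1) \<noteq> l (w 2)" using j0 by simp
    then obtain s where s: "s \<noteq> 0" "l (w s) \<noteq> 0" by (metis zero_neq_one zero_neq_numeral)
    have "A \<noteq> 0" by (simp add: A_def J_def)
    moreover have "(\<Prod>i\<in>J. w s $ i) \<noteq> 0" using s(1) by (simp add: w_def)
    ultimately have "P (w s) \<noteq> 0" using s(2) by (simp add: P_def)
    moreover have "w s $ k = 0" using \<open>j0 \<in> J\<close> \<open>k \<notin> J\<close> by (auto simp: w_def)
    ultimately show ?thesis using chart_direction_surj by metis
  qed
  then obtain v1 where "P (chart_direction k v1) \<noteq> 0" by blast
  then have card: "card R = Suc (card J)"
    using limit_quotient_power_eq_0[OF limP limQ, of v0] limit_quotient_power_eq_0[OF limQ limP, of v1] Q0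
    by (meson linorder_neqE_nat)
  have PQ: "P (chart_direction k v) = Q v" for v
    using tendsto_unique[OF trivial_limit_at limP] limQ[unfolded card] by blast

  have L_diff: "L i (v - w) = L i v - L i w" for i v w
    using has_derivative_linear[OF L(1)] by (rule linear_diff)
  have L_sum: "L i (\<Sum>j\<in>S. h j) = (\<Sum>j\<in>S. L i (h j))" for i and h :: "'n option \<Rightarrow> _" and S
    using has_derivative_linear[OF L(1)] by (rule linear_sum)
  \<comment> \<open>Such a direction leaves \<open>P\<close> unchanged, because \<open>l\<close>
    involves only coordinates in \<open>J\<close>. If \<open>L r v\<close> were nonzero, moving
    \<open>v0\<close> along \<open>v\<close> into the hyperplane \<open>L r = 0\<close> would kill
    \<open>Q\<close> without changing \<open>P\<close>.\<close>
  have kernel: "L r v = 0" if "r \<in> R" "\<And>j. j \<in> J \<Longrightarrow> chart_direction k v $ j = 0" for r v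
  proof (rule ccontr)
    assume "L r v \<noteq> 0"
    define c where "c = 1 / L r v"
    have P_inv: "P (w - c *s chart_direction k v) = P w" for w
    proof -
      have "l (w - c *s chart_direction k v) = l w"
        unfolding l_def using grad that(2) by (intro sum.cong) (auto simp: J_def)
      moreover have "(\<Prod>i\<in>J. (w - c *s chart_direction k v) $ i) = (\<Prod>i\<in>J. w $ i)"
        using that(2) by (intro prod.cong) auto
      ultimately show ?thesis by (simp add: P_def)
    qed
    have "Q (v0 - c *s v) = Q v0" unfolding PQ[symmetric] chart_direction_linear P_inv ..
    moreover have "L r (v0 - c *s v) = 0" using \<open>L r v \<noteq> 0\<close> by (simp add: L_diff L(2) v0 c_def)
    then have "Q (v0 - c *s v) = 0" using \<open>r \<in> R\<close> by (auto simp: Q_def)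
    ultimately show False using Q0 by simp
  qed
  have "\<exists>v. chart_direction k v = axis j 1" if "j \<in> J" for j
    using that \<open>k \<notin> J\<close> by (intro chart_direction_surj) (auto simp: axis_def)
  then obtain b where b: "\<And>j. j \<in> J \<Longrightarrow> chart_direction k (b j) = axis j 1" by metis
  \<comment> \<open>By \<open>kernel\<close> the forms \<open>L r\<close>, \<open>r \<in> R\<close>,
    depend only on the coordinates in \<open>J\<close>, and \<open>R\<close> has one element more
    than \<open>J\<close>; so they are dependent. The vector \<open>v\<close> dual to
    \<open>r0\<close> contradicts this.\<close>
  obtain \<alpha> r0 where \<alpha>: "r0 \<in> R" "\<alpha> r0 \<noteq> 0" "\<And>j. j \<in> J \<Longrightarrow> (\<Sum>r\<in>R. \<alpha> r * L r (b j)) = 0"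
    using nontrivial_relation[of J R "\<lambda>r j. L r (b j)"] card by auto
  obtain v where v: "\<And>i. L i v = (if i = r0 then 1 else 0)"
    using L(3)[of "\<lambda>i. if i = r0 then 1 else 0"] by auto
  define x where "x = chart_direction k v"
  have "L r v = (\<Sum>j\<in>J. x $ j * L r (b j))" if "r \<in> R" for r
  proof -
    have "L r (v - (\<Sum>j\<in>J. x $ j *s b j)) = 0"
    proof (rule kernel[OF that])
      fix j assume "j \<in> J"
      have "(\<Sum>i\<in>J. x $ i *s chart_direction k (b i)) $ j = (\<Sum>i\<in>J. if i = j then x $ i else 0)"
        unfolding sum_component by (intro sum.cong) (auto simp: b axis_def)
      then show "chart_direction k (v - (\<Sum>j\<in>J. x $ j *s b j)) $ j = 0"
        using \<open>j \<in> J\<close> by (simp add: chart_direction_linear x_def)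
    qed
    then show ?thesis by (simp add: L_diff L_sum L(2))
  qed
  then have "(\<Sum>r\<in>R. \<alpha> r * L r v) = (\<Sum>r\<in>R. \<Sum>j\<in>J. x $ j * (\<alpha> r * L r (b j)))"
    by (intro sum.cong) (simp_all add: sum_distrib_left algebra_simps)
  also have "\<dots> = (\<Sum>j\<in>J. x $ j * (\<Sum>r\<in>R. \<alpha> r * L r (b j)))"
    by (subst sum.swap) (simp add: sum_distrib_left)
  also have "\<dots> = 0" using \<alpha>(3) by simp
  also have "(\<Sum>r\<in>R. \<alpha> r * L r v) = \<alpha> r0" using \<alpha>(1) by (simp add: v if_distrib cong: if_cong)
  finally show False using \<alpha>(2) by simp
qed

section \<open>Jacobian syzygies of \<open>f\<close>\<close>

text \<open>Reduction modulo \<open>x_j\<close>, realised inside the same ring by substituting 0 for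
  that variable.\<close>

definition kill_var :: "'v \<Rightarrow> 'v mpoly \<Rightarrow> 'v mpoly" where
  "kill_var j p = Poly_Mapping.mapp (\<lambda>m c. c when lookup m j = 0) p"

lemma lookup_kill_var: "lookup (kill_var j p) m = (lookup p m when lookup m j = 0)"
  by (auto simp: kill_var_def lookup_mapp when_def in_keys_iff)

lemma kill_var_zero [simp]: "kill_var j 0 = 0"
  by (intro poly_mapping_eqI) (simp add: lookup_kill_var)

lemma kill_var_add [simp]: "kill_var j (p + q) = kill_var j p + kill_var j q"
  by (intro poly_mapping_eqI) (simp add: lookup_kill_var lookup_add when_def)

lemma kill_var_single: "kill_var j (single m c) = (if lookup m j = 0 then single m c else 0)"
  by (intro poly_mapping_eqI) (auto simp: lookup_kill_var lookup_single when_def)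

lemma kill_var_mult [simp]: "kill_var j (p * q) = kill_var j p * kill_var j q"
  by (rule additive_multI) (auto simp: kill_var_single lookup_add mult_single)

lemma kill_var_Var: "kill_var j (Var i) = (if i = j then 0 else Var i)"
  by (auto simp: Var_def kill_var_single lookup_single when_def)

lemma kill_var_sum: "kill_var j (\<Sum>i\<in>A. p i) = (\<Sum>i\<in>A. kill_var j (p i))"
  by (induction A rule: infinite_finite_induct) auto

lemma kill_var_prod_Var:
  "finite A \<Longrightarrow> kill_var j (\<Prod>i\<in>A. Var i) = (if j \<in> A then 0 else \<Prod>i\<in>A. Var i)"
proof (induction A rule: finite_induct)
  case empty
  have "kill_var j (single 0 1) = single 0 1" unfolding kill_var_single by simp
  then show ?case by (simp add: single_one)
qed (auto simp: kill_var_Var)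

lemma kill_var_eq_0: "kill_var j p = 0 \<Longrightarrow> \<exists>q. p = Var j * q"
proof -
  assume *: "kill_var j p = 0"
  have "p \<in> power_ideal (\<lambda>_. 1) (insert j {})"
    unfolding power_ideal_def
  proof (rule CollectI, rule ballI)
    fix m assume "m \<in> keys p"
    moreover have "lookup (kill_var j p) m = 0" by (simp add: *)
    ultimately show "\<exists>i\<in>insert j {}. 1 \<le> lookup m i"
      by (auto simp: lookup_kill_var in_keys_iff when_def split: if_splits)
  qed
  from diff_quot_in_power_ideal[OF this] have "p - Var j * quot j 1 p = 0"
    by (auto simp: power_ideal_def)
  then show ?thesis by auto
qed

lemma partial_deriv_prod_Var_mult:
  "partial_deriv j ((\<Prod>i\<in>UNIV. Var i) * g) = (\<Prod>i\<in>UNIV - {j}. Var i) * g' g j"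
  for g :: "('v::finite) mpoly"
proof -
  have X: "(\<Prod>i\<in>UNIV. Var i) = Var j * (\<Prod>i\<in>UNIV - {j}. Var i :: 'v mpoly)"
    by (rule prod.remove) auto
  show ?thesis
    by (simp add: partial_deriv_mult partial_deriv_prod_Var) (simp add: X g'_def algebra_simps)
qed

lemma D0_prod_Var_mult:
  fixes g :: "('v::finite) mpoly"
  shows "(\<chi> j. Var j * b j) \<in> D0 ((\<Prod>i\<in>UNIV. Var i) * g) \<longleftrightarrow> (\<Sum>j\<in>UNIV. b j * g' g j) = 0"
proof -
  define X where "X = (\<Prod>i\<in>UNIV. Var i :: 'v mpoly)"
  have X: "X = Var j * (\<Prod>i\<in>UNIV - {j}. Var i)" for j
    unfolding X_def by (rule prod.remove) auto
  have "(\<Sum>j\<in>UNIV. (Var j * b j) * ((\<Prod>i\<in>UNIV - {j}. Var i) * g' g j)) =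
      X * (\<Sum>j\<in>UNIV. b j * g' g j)"
    unfolding sum_distrib_left
  proof (intro sum.cong refl)
    fix j
    show "Var j * b j * ((\<Prod>i\<in>UNIV - {j}. Var i) * g' g j) = X * (b j * g' g j)"
      unfolding X[of j] by (simp add: mult_ac)
  qed
  moreover have "X * p = 0 \<longleftrightarrow> p = 0" for p
    using prod_Var_cancel[of UNIV p 0] by (auto simp: X_def)
  ultimately show ?thesis by (simp add: D0_def partial_deriv_prod_Var_mult)
qed

text \<open>Modulo \<open>x_j\<close> every term of the syzygy except the \<open>j\<close>-th
  contains the factor \<open>x_j\<close>, and \<open>g'_j\<close> reduces to \<open>g\<close>. What
  remains is \<open>a $ j\<close> times a nonzero polynomial.\<close>

lemma D0_Var_dvd:
  fixes g :: "('v::{finite,linorder}) mpoly"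
  assumes "a \<in> D0 ((\<Prod>i\<in>UNIV. Var i) * g)" "kill_var j g \<noteq> 0"
  shows "\<exists>q. a $ j = Var j * q"
proof (rule kill_var_eq_0)
  have "(\<Sum>i\<in>UNIV. a $ i * ((\<Prod>l\<in>UNIV - {i}. Var l) * g' g i)) = 0"
    using assms(1) by (simp add: D0_def partial_deriv_prod_Var_mult)
  then have "0 = kill_var j (\<Sum>i\<in>UNIV. a $ i * ((\<Prod>l\<in>UNIV - {i}. Var l) * g' g i))" by simp
  also have "\<dots> = (\<Sum>i\<in>UNIV. if i = j then kill_var j (a $ j) * ((\<Prod>l\<in>UNIV - {j}. Var l) * kill_var j g) else 0)"
    unfolding kill_var_sum
    by (intro sum.cong) (auto simp: kill_var_prod_Var g'_def kill_var_Var)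
  finally have "kill_var j (a $ j) * ((\<Prod>l\<in>UNIV - {j}. Var l) * kill_var j g) = 0" by simp
  moreover have "(\<Prod>l\<in>UNIV - {j}. Var l) * kill_var j g \<noteq> 0"
    using prod_Var_cancel[of "UNIV - {j}" "kill_var j g" 0] assms(2) by auto
  \<comment> \<open>Absence of zero divisors is used here; the linear order on the variables
    provides it through an order on monomials.\<close>
  ultimately show "kill_var j (a $ j) = 0" by simp
qed

text \<open>If \<open>x_j\<close> divided \<open>g\<close>, it would divide every
  \<open>g'_i\<close>, and any coordinate point on \<open>x_j = 0\<close> would be a common
  zero.\<close>

lemma kill_var_g_nonzero:
  fixes g :: "('v::finite) mpoly"
  assumes zero: "\<And>p. (\<And>i. eval_mpoly (g' g i) p = 0) \<Longrightarrow> p = 0" and "k \<noteq> j"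
  shows "kill_var j g \<noteq> 0"
proof
  assume "kill_var j g = 0"
  from kill_var_eq_0[OF this] obtain h where h: "g = Var j * h" ..
  have "eval_mpoly (g' g i) (axis k 1) = 0" for i
    using \<open>k \<noteq> j\<close> by (cases "i = j") (simp_all add: g'_def h partial_deriv_mult partial_deriv_Var axis_def)
  then have "axis k 1 = (0 :: complex ^ 'v)" by (rule zero)
  then show False by simp
qed

section \<open>Generation and minimality of the Koszul syzygies\<close>

lemma sum_less_pairs:
  fixes A B :: "'v::{finite,linorder} \<Rightarrow> 'v \<Rightarrow> 'a::comm_monoid_add"
  shows "(\<Sum>(i, j)\<in>{(i, j). i < j}. (if k = i then A i j else if k = j then B i j else 0)) =
    (\<Sum>j\<in>{k<..}. A k j) + (\<Sum>i\<in>{..<k}. B i k)"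
proof -
  have "(\<Sum>(i, j)\<in>{(i, j). i < j}. (if k = i then A i j else if k = j then B i j else 0)) =
      (\<Sum>(i, j)\<in>UNIV \<times> UNIV. (if k = i then (if k < j then A k j else 0) else 0) +
        (if k = j then (if i < k then B i k else 0) else 0))"
    by (rule sum.mono_neutral_cong_left) (auto split: if_splits)
  also have "\<dots> = (\<Sum>i\<in>UNIV. \<Sum>j\<in>UNIV. (if k = i then (if k < j then A k j else 0) else 0)) +
      (\<Sum>i\<in>UNIV. \<Sum>j\<in>UNIV. (if k = j then (if i < k then B i k else 0) else 0))"
    unfolding sum.cartesian_product[symmetric] sum.distrib ..
  also have "(\<Sum>i\<in>UNIV. \<Sum>j\<in>UNIV. (if k = i then (if k < j then A k j else 0) else 0)) =
      (\<Sum>j\<in>UNIV. if k < j then A k j else 0)"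
    by (subst sum.swap) simp
  also have "\<dots> = (\<Sum>j\<in>{k<..}. A k j)" by (rule sum.mono_neutral_cong_right) auto
  also have "(\<Sum>i\<in>UNIV. \<Sum>j\<in>UNIV. (if k = j then (if i < k then B i k else 0) else 0)) =
      (\<Sum>i\<in>UNIV. if i < k then B i k else 0)"
    by simp
  also have "\<dots> = (\<Sum>i\<in>{..<k}. B i k)" by (rule sum.mono_neutral_cong_right) auto
  finally show ?thesis .
qed

lemma \<rho>'_in_D0:
  fixes g :: "('v::finite) mpoly"
  assumes "i \<noteq> j"
  shows "\<rho>' g i j \<in> D0 ((\<Prod>i\<in>UNIV. Var i) * g)"
proof -
  define b where "b k = (if k = i then g' g j else if k = j then - g' g i else 0)" for k
  have "\<rho>' g i j = (\<chi> k. Var k * b k)" by (auto simp: \<rho>'_def b_def vec_eq_iff)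
  moreover have "(\<Sum>k\<in>UNIV. b k * g' g k) = (\<Sum>k\<in>{i, j}. b k * g' g k)"
    by (rule sum.mono_neutral_right) (auto simp: b_def)
  then have "(\<Sum>k\<in>UNIV. b k * g' g k) = 0" using assms by (simp add: b_def)
  ultimately show ?thesis by (simp add: D0_prod_Var_mult)
qed

lemma subspace_D0: "module.subspace (*s) (D0 f)"
  unfolding module.subspace_def[OF module_vec] D0_def
  by (auto simp: algebra_simps sum.distrib simp flip: sum_distrib_left)

lemma minimal_generators_D0:
  fixes g :: "('v::{finite,linorder}) mpoly"
  assumes hom: "homogeneous e g" and "e > 0"
    and zero: "\<And>p. (\<And>i. eval_mpoly (g' g i) p = 0) \<Longrightarrow> p = 0"
    and card: "CARD('v) \<ge> 2"
  shows "minimal_generators {(i, j). i < j} (\<lambda>(i, j). \<rho>' g i j) (D0 ((\<Prod>i\<in>UNIV. Var i) * g))"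
proof -
  define f where "f = (\<Prod>i\<in>UNIV. Var i) * g"
  define I where "I = {(i, j :: 'v). i < j}"
  define \<rho> where "\<rho> = (\<lambda>(i, j). \<rho>' g i j)"
  have koszul: "\<exists>\<eta>. (\<forall>i j. \<eta> i j = - \<eta> j i) \<and> (\<forall>j. b j = (\<Sum>i\<in>UNIV. g' g i * \<eta> i j))"
    if "(\<Sum>i\<in>UNIV. b i * g' g i) = 0" for b
    by (rule koszul_syzygies) (fact homogeneous_g'[OF hom] zero that)+
  have "a \<in> module.span (*s) (\<rho> ` I)" if a: "a \<in> D0 f" for a
  proof -
    have "\<exists>q. a $ j = Var j * q" for j
    proof -
      obtain k where "k \<noteq> j"
      proof (rule ccontr)
        assume "\<not> thesis"
        then have "UNIV = {j}" using that by auto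
        then have "CARD('v) = card {j}" by simp
        then show False using card by simp
      qed
      then show ?thesis using D0_Var_dvd[OF a[unfolded f_def]] kill_var_g_nonzero[of g, OF zero] by blast
    qed
    then obtain b where b: "\<And>j. a $ j = Var j * b j" by metis
    then have "a = (\<chi> j. Var j * b j)" by (simp add: vec_eq_iff)
    then have "(\<Sum>j\<in>UNIV. b j * g' g j) = 0" using a by (simp add: f_def D0_prod_Var_mult)
    from koszul[OF this] obtain \<eta> where anti: "\<And>i j. \<eta> i j = - \<eta> j i"
      and \<eta>: "\<And>j. b j = (\<Sum>i\<in>UNIV. g' g i * \<eta> i j)" by blast
    have "a = (\<Sum>(i, j)\<in>I. \<eta> j i *s \<rho> (i, j))"
    proof (rule vec_eq_iff[THEN iffD2], rule allI)
      fix k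
      have "(\<Sum>(i, j)\<in>I. \<eta> j i *s \<rho> (i, j)) $ k = (\<Sum>(i, j)\<in>I. if k = i then \<eta> j i * (Var i * g' g j)
          else if k = j then \<eta> j i * - (Var j * g' g i) else 0)"
        unfolding sum_component by (intro sum.cong) (auto simp: \<rho>_def \<rho>'_def)
      \<comment> \<open>The index \<open>k\<close> is either the smaller or the larger one of a
        pair. Antisymmetry of \<open>\<eta>\<close> gives both halves the same shape, and
        \<open>\<eta> k k = 0\<close> fills the gap between them.\<close>
      also have "\<dots> = (\<Sum>j\<in>{k<..}. \<eta> j k * (Var k * g' g j)) + (\<Sum>i\<in>{..<k}. \<eta> k i * - (Var k * g' g i))"
        unfolding I_def by (rule sum_less_pairs)
      also have "(\<Sum>i\<in>{..<k}. \<eta> k i * - (Var k * g' g i)) = (\<Sum>i\<in>{..<k}. \<eta> i k * (Var k * g' g i))"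
        by (intro sum.cong refl) (subst anti, simp)
      also have "(\<Sum>j\<in>{k<..}. \<eta> j k * (Var k * g' g j)) + \<dots> =
          (\<Sum>i\<in>{k<..} \<union> {..<k}. \<eta> i k * (Var k * g' g i))"
        by (rule sum.union_disjoint[symmetric]) auto
      also have "\<dots> = (\<Sum>i\<in>UNIV. \<eta> i k * (Var k * g' g i))"
      proof (rule sum.mono_neutral_left)
        have "\<eta> k k = 0" using anti[of k k] by (rule mpoly_eq_uminus_self)
        then show "\<forall>i\<in>UNIV - ({k<..} \<union> {..<k}). \<eta> i k * (Var k * g' g i) = 0"
          by (auto simp: not_less)
      qed auto
      also have "\<dots> = a $ k" by (simp add: b \<eta> sum_distrib_left mult_ac)
      finally show "a $ k = (\<Sum>(i, j)\<in>I. \<eta> j i *s \<rho> (i, j)) $ k" ..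
    qed
    also have "\<dots> \<in> module.span (*s) (\<rho> ` I)"
      by (rule module.span_sum[OF module_vec])
         (clarify, intro module.span_scale[OF module_vec] module.span_base[OF module_vec] imageI)
    finally show ?thesis .
  qed
  moreover have "\<rho> ` I \<subseteq> D0 f" by (auto simp: \<rho>_def I_def f_def intro!: \<rho>'_in_D0)
  then have "module.span (*s) (\<rho> ` I) \<subseteq> D0 f"
    by (intro module.span_minimal[OF module_vec] subspace_D0)
  ultimately have span: "module.span (*s) (\<rho> ` I) = D0 f" by blast
  have "module.span (*s) (\<rho> ` J) \<noteq> D0 f" if J: "J \<subset> I" for J
  proof
    assume J_span: "module.span (*s) (\<rho> ` J) = D0 f"
    obtain i j where ij: "i < j" "(i, j) \<notin> J" using J by (auto simp: I_def)
    \<comment> \<open>Among increasing pairs only \<open>(i, j)\<close> puts \<open>g'_j\<close>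
      into component \<open>i\<close>, so this submodule contains all other \<open>\<rho>'\<close>.
      Membership of \<open>\<rho>' g i j\<close> would express \<open>g'_j\<close> through the
      remaining \<open>g'_l\<close>.\<close>
    define T where "T = {a. \<exists>c. c j = 0 \<and> a $ i = Var i * (\<Sum>l\<in>UNIV. c l * g' g l)}"
    have "module.subspace (*s) T"
      unfolding module.subspace_def[OF module_vec]
    proof (intro conjI ballI allI)
      show "0 \<in> T" unfolding T_def by (intro CollectI exI[of _ "\<lambda>_. 0"]) simp
    next
      fix a b assume "a \<in> T" "b \<in> T"
      then obtain c d where "c j = 0" "a $ i = Var i * (\<Sum>l\<in>UNIV. c l * g' g l)"
        "d j = 0" "b $ i = Var i * (\<Sum>l\<in>UNIV. d l * g' g l)" by (auto simp: T_def)
      then show "a + b \<in> T" unfolding T_def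
        by (intro CollectI exI[of _ "\<lambda>l. c l + d l"]) (simp add: algebra_simps sum.distrib)
    next
      fix r a assume "a \<in> T"
      then obtain c where "c j = 0" "a $ i = Var i * (\<Sum>l\<in>UNIV. c l * g' g l)" by (auto simp: T_def)
      then show "r *s a \<in> T" unfolding T_def
        by (intro CollectI exI[of _ "\<lambda>l. r * c l"]) (simp add: mult_ac sum_distrib_left)
    qed
    moreover have "\<rho> ` J \<subseteq> T"
    proof
      fix a assume "a \<in> \<rho> ` J"
      then obtain k l where kl: "a = \<rho>' g k l" "(k, l) \<in> J" by (auto simp: \<rho>_def)
      then have "k < l" using J by (auto simp: I_def)
      define c :: "'v \<Rightarrow> 'v mpoly" where "c m = (if k = i \<and> m = l then 1 else if l = i \<and> m = k then - 1 else 0)" for m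
      have "c j = 0" using kl ij \<open>k < l\<close> by (auto simp: c_def)
      moreover have "(\<Sum>m\<in>UNIV. c m * g' g m) = (\<Sum>m\<in>{k, l}. c m * g' g m)"
        by (rule sum.mono_neutral_right) (auto simp: c_def)
      then have "a $ i = Var i * (\<Sum>m\<in>UNIV. c m * g' g m)"
        using \<open>k < l\<close> by (auto simp: kl \<rho>'_def c_def)
      ultimately show "a \<in> T" by (auto simp: T_def)
    qed
    ultimately have "D0 f \<subseteq> T"
      unfolding J_span[symmetric] by (intro module.span_minimal[OF module_vec])
    moreover have "\<rho>' g i j \<in> D0 f" using ij by (simp add: f_def \<rho>'_in_D0)
    ultimately obtain c where c: "c j = 0" "Var i * g' g j = Var i * (\<Sum>l\<in>UNIV. c l * g' g l)"
      by (auto simp: T_def \<rho>'_def)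
    define b where "b l = (if l = j then 1 else 0) - c l" for l
    have "(\<Sum>l\<in>UNIV. b l * g' g l) = g' g j - (\<Sum>l\<in>UNIV. c l * g' g l)"
      by (simp add: b_def left_diff_distrib sum_subtractf if_distrib[of "\<lambda>x. x * _"] cong: if_cong)
    also have "\<dots> = 0" using c(2) unfolding Var_cancel by simp
    finally obtain \<eta> where "b j = (\<Sum>i\<in>UNIV. g' g i * \<eta> i j)" using koszul[of b] by blast
    then have "1 = (\<Sum>i\<in>UNIV. g' g i * \<eta> i j)" using c(1) by (simp add: b_def)
    \<comment> \<open>Forms of positive degree \<open>e\<close> vanish at the origin, so 1 is not in
      their ideal.\<close>
    then have "eval_mpoly 1 0 = eval_mpoly (\<Sum>i\<in>UNIV. g' g i * \<eta> i j) 0" by simp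
    also have "\<dots> = 0"
      using homogeneous_eval_scale[OF homogeneous_g'[OF hom], where c = 0 and x = 0] \<open>e > 0\<close>
      by (simp add: power_0_left)
    finally show False by simp
  qed
  then show ?thesis using span unfolding minimal_generators_def f_def I_def \<rho>_def by blast
qed

theorem corollary1p2:
  fixes g f :: "(('n::{finite,linorder}) option) mpoly"
    and e :: nat
  assumes "CARD('n) \<ge> 2"
    and "e > 0"
    and "homogeneous e g"
    and "smooth_hypersurface g"
    and "f = (\<Prod>i\<in>UNIV. Var i) * g"
    and "normal_crossing_divisor f"
  shows "(\<forall>i j k. i < j \<longrightarrow> homogeneous (e + 1) (\<rho>' g i j $ k)) \<and>
    minimal_generators {(i, j). i < j} (\<lambda>(i, j). \<rho>' g i j) (D0 f)"
proof
  have "homogeneous (e + 1) (Var i * g' g j)" for i j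
    using homogeneous_mult[OF homogeneous_Var homogeneous_g'[OF assms(3)]] by simp
  then show "\<forall>i j k. i < j \<longrightarrow> homogeneous (e + 1) (\<rho>' g i j $ k)"
    by (simp add: \<rho>'_def homogeneous_uminus homogeneous_zero)
  have "p = 0" if "\<And>i. eval_mpoly (g' g i) p = 0" for p
    by (rule no_common_zero_of_g'[OF assms(3-6) that])
  then show "minimal_generators {(i, j). i < j} (\<lambda>(i, j). \<rho>' g i j) (D0 f)"
    unfolding assms(5) using assms(1) by (intro minimal_generators_D0[OF assms(3,2)]) simp_all
qed

end
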